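(* Let $(X,\mu)$ and $(Y,\nu)$ be $\sigma$-finite measure spaces. Let $0<p_0<p<p_1\le\infty$ and $0<q_0,q_1\le\infty$. Let $T$ be a quasi-additive (respectively, subadditive) operator defined on $L^{p_0,1}(X)+L^{p_1,1}(X)$ with values in $\mathscr M(Y)$; in the quasi-additive case let $K>1$ denote its quasi-additivity constant. Assume that there are positive constants $C_0,C_1$ such that $$\|T(f)\|_{L^{q_0,\infty}(Y)}\le C_0\|f\|_{L^{p_0,1}(X)}\quad\text{for all } f\in L^{p_0,1}(X),$$ $$\|T(f)\|_{L^{q_1,\infty}(Y)}\le C_1\|f\|_{L^{p_1,1}(X)}\quad\text{for all } f\in L^{p_1,1}(X).$$ Then $T$ is countably $\alpha$-quasi-additive (respectively, countably subadditive) on $L^{p,r}(X)$ for any $0<r\le\infty$, where $\alpha$ is related to $K$ via $(2K)^\alpha=2$.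
   Context: $\mathscr M(X)$ and $\mathscr M(Y)$ denote the spaces of complex-valued measurable functions on $X$ and $Y$. Decreasing rearrangement: for $f\in\mathscr M(X)$ and $t\in[0,\infty)$, $f^*(t)=\inf\{s>0:\mu(\{|f|>s\})\le t\}$. For $0<p,q\le\infty$, the Lorentz space $L^{p,q}(X)$ is the space of all complex-valued measurable $f$ on $X$ for which the quasi-norm $\|f\|_{L^{p,q}(X)}$ is finite, where $\|f\|_{L^{p,q}(X)}=\left(\int_0^\infty (t^{1/p}f^*(t))^q\,\frac{dt}{t}\right)^{1/q}$ if $q<\infty$ and $\|f\|_{L^{p,\infty}(X)}=\sup_{t>0}t^{1/p}f^*(t)$. Similarly for $Y$. Let $T$ be a (not necessarily linear) mapping with values in $\mathscr M(Y)$ defined on a space $W$ of measurable functions on $X$ (a Lorentz space or a sum of Lorentz spaces). - $T$ is subadditive on $W$ if $|T(f+g)|\le|T(f)|+|T(g)|$ $\nu$-a.e. for all $f,g\in W$. - $T$ is quasi-additive on $W$ if there is a constant $K>1$ (the quasi-additivity constant) such that $|T(f+g)|\le K(|T(f)|+|T(g)|)$ $\nu$-a.e. for all $f,g\in W$. - $T$ is countably subadditive on $L^{p,r}(X)$ if whenever $\sum_{j\in\mathbf Z}f_j$ converges in $L^{p,r}(X)$, one has $|T(\sum_{j\in\mathbf Z}f_j)|\le\sum_{j\in\mathbf Z}|T(f_j)|$ $\nu$-a.e. - $T$ is countably $\alpha$-quasi-additive on $L^{p,r}(X)$, for some $0<\alpha\le1$, if there is a constant $K'\ge1$ such that whenever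 $\sum_{j\in\mathbf Z}f_j$ converges in $L^{p,r}(X)$, one has $|T(\sum_{j\in\mathbf Z}f_j)|^\alpha\le K'\sum_{j\in\mathbf Z}|T(f_j)|^\alpha$ $\nu$-a.e.
   Formalization: For p_1=∞ the literal L^{∞,1} contains only functions that vanish a.e., so T need not be defined on L^{p,r}(X); there the inclusion of L^{p,r}(X) in L^{p_0,1}(X)+L^{∞,1}(X) is assumed. The reading L^{∞,1}=L^∞ is also covered, with no added assumption. *)

theory Defs
  imports "HOL-Analysis.Analysis"
begin

text \<open>All exponents live in \<open>(0, \<infinity>]\<close> and are elements of \<^typ>\<open>ennreal\<close>; norms and rearrangements
  are \<^typ>\<open>ennreal\<close>-valued. Functions are not identified when they agree almost everywhere, and
  operators act on functions.\<close>

text \<open>Real powers on \<open>[0, \<infinity>]\<close>, meant for exponents \<open>a > 0\<close>.\<close>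

definition ennpow :: "ennreal \<Rightarrow> real \<Rightarrow> ennreal" where
  "ennpow x a = (if x = \<infinity> then \<infinity> else ennreal (enn2real x powr a))"

text \<open>The infimum of the empty set is \<open>\<infinity>\<close>.\<close>

definition rearrangement :: "'a measure \<Rightarrow> ('a \<Rightarrow> complex) \<Rightarrow> real \<Rightarrow> ennreal" where
  "rearrangement M f t =
     (INF s\<in>{s::real. 0 < s \<and> emeasure M {x \<in> space M. s < cmod (f x)} \<le> ennreal t}. ennreal s)"

text \<open>For \<open>p = \<infinity>\<close> the weight \<open>t powr (1/p)\<close> is \<open>1\<close>, since \<open>1 / \<infinity> = 0\<close> in \<^typ>\<open>ennreal\<close>.\<close>

definition lorentz_norm ::
    "'a measure \<Rightarrow> ennreal \<Rightarrow> ennreal \<Rightarrow> ('a \<Rightarrow> complex) \<Rightarrow> ennreal" where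
  "lorentz_norm M p q f =
     (if q = \<infinity>
      then (SUP t\<in>{0<..}. ennreal (t powr enn2real (1 / p)) * rearrangement M f t)
      else ennpow
             (\<integral>\<^sup>+t\<in>{0<..}. (ennpow (ennreal (t powr enn2real (1 / p)) * rearrangement M f t)
                (enn2real q) * ennreal (1 / t)) \<partial>lborel)
             (enn2real (1 / q)))"

definition lorentz_space ::
    "'a measure \<Rightarrow> ennreal \<Rightarrow> ennreal \<Rightarrow> ('a \<Rightarrow> complex) set" where
  "lorentz_space M p q = {f \<in> borel_measurable M. lorentz_norm M p q f < \<infinity>}"

definition space_sum ::
    "('a \<Rightarrow> complex) set \<Rightarrow> ('a \<Rightarrow> complex) set \<Rightarrow> ('a \<Rightarrow> complex) set" where
  "space_sum A B = {(\<lambda>x. f x + g x) | f g. f \<in> A \<and> g \<in> B}"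

text \<open>Second index \<open>s\<close> of the endpoint space written \<open>L\<^sup>p\<^sup>,\<^sup>1\<close>. For finite \<open>p\<close> it is \<open>1\<close>. With
  the definition of \<^const>\<open>lorentz_norm\<close> the space \<open>L\<^sup>\<infinity>\<^sup>,\<^sup>1\<close> contains only functions vanishing
  almost everywhere, and in interpolation theorems the symbol often stands for
  \<open>L\<^sup>\<infinity> = L\<^sup>\<infinity>\<^sup>,\<^sup>\<infinity>\<close>; both conventions are admitted when \<open>p = \<infinity>\<close>.\<close>

definition endpoint_index :: "ennreal \<Rightarrow> ennreal \<Rightarrow> bool" where
  "endpoint_index p s \<longleftrightarrow> s = 1 \<or> (p = \<infinity> \<and> s = \<infinity>)"

definition subadditive_op ::
    "'b measure \<Rightarrow> ('a \<Rightarrow> complex) set \<Rightarrow> (('a \<Rightarrow> complex) \<Rightarrow> 'b \<Rightarrow> complex) \<Rightarrow> bool" where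
  "subadditive_op N W T \<longleftrightarrow>
     (\<forall>f\<in>W. \<forall>g\<in>W. AE y in N. cmod (T (\<lambda>x. f x + g x) y) \<le> cmod (T f y) + cmod (T g y))"

definition quasi_additive_op ::
    "'b measure \<Rightarrow> ('a \<Rightarrow> complex) set \<Rightarrow> real \<Rightarrow> (('a \<Rightarrow> complex) \<Rightarrow> 'b \<Rightarrow> complex) \<Rightarrow> bool" where
  "quasi_additive_op N W K T \<longleftrightarrow> 1 < K \<and>
     (\<forall>f\<in>W. \<forall>g\<in>W. AE y in N.
        cmod (T (\<lambda>x. f x + g x) y) \<le> K * (cmod (T f y) + cmod (T g y)))"

text \<open>Convergence of the two-sided series is that of the symmetric partial sums, the weakest of the
  usual notions.\<close>

definition lorentz_series ::
    "'a measure \<Rightarrow> ennreal \<Rightarrow> ennreal \<Rightarrow> (int \<Rightarrow> 'a \<Rightarrow> complex) \<Rightarrow> ('a \<Rightarrow> complex) \<Rightarrow> bool" where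
  "lorentz_series M p r F f \<longleftrightarrow>
     (\<forall>j. F j \<in> lorentz_space M p r) \<and> f \<in> lorentz_space M p r \<and>
     (\<lambda>n. lorentz_norm M p r (\<lambda>x. f x - (\<Sum>j\<in>{- int n..int n}. F j x))) \<longlonglongrightarrow> 0"

text \<open>The series on the right-hand sides below are taken in \<open>[0, \<infinity>]\<close>.\<close>

definition countably_subadditive_op ::
    "'a measure \<Rightarrow> 'b measure \<Rightarrow> ennreal \<Rightarrow> ennreal \<Rightarrow>
     (('a \<Rightarrow> complex) \<Rightarrow> 'b \<Rightarrow> complex) \<Rightarrow> bool" where
  "countably_subadditive_op M N p r T \<longleftrightarrow>
     (\<forall>F f. lorentz_series M p r F f \<longrightarrow>
        (AE y in N. ennreal (cmod (T f y)) \<le> (\<Sum>\<^sub>\<infinity>j. ennreal (cmod (T (F j) y)))))"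

definition countably_quasi_additive_op ::
    "'a measure \<Rightarrow> 'b measure \<Rightarrow> ennreal \<Rightarrow> ennreal \<Rightarrow> real \<Rightarrow>
     (('a \<Rightarrow> complex) \<Rightarrow> 'b \<Rightarrow> complex) \<Rightarrow> bool" where
  "countably_quasi_additive_op M N p r \<alpha> T \<longleftrightarrow> 0 < \<alpha> \<and> \<alpha> \<le> 1 \<and>
     (\<exists>K'::real. 1 \<le> K' \<and>
       (\<forall>F f. lorentz_series M p r F f \<longrightarrow>
          (AE y in N. ennreal (cmod (T f y) powr \<alpha>)
             \<le> ennreal K' * (\<Sum>\<^sub>\<infinity>j. ennreal (cmod (T (F j) y) powr \<alpha>)))))"

end

theory Submission
  imports Defs
begin

text \<open>Write \<open>f = S\<^sub>n + R\<^sub>n\<close> with \<open>S\<^sub>n\<close> the symmetric partial sums. Since \<open>R\<^sub>n \<rightarrow> 0\<close> in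
  \<open>L\<^sup>p\<^sup>,\<^sup>r\<close>, hence in \<open>L\<^sup>p\<^sup>,\<^sup>\<infinity>\<close>, truncation at a small level gives \<open>R\<^sub>n = g\<^sub>n + h\<^sub>n\<close> with \<open>g\<^sub>n\<close> and
  \<open>h\<^sub>n\<close> tending to \<open>0\<close> in the two endpoint spaces. The endpoint bounds then make \<open>T R\<^sub>n\<close> tend to \<open>0\<close>
  in measure, so \<open>\<bar>T R\<^sub>n\<bar>\<close> takes arbitrarily small values almost everywhere. It remains to bound \<open>T\<close>
  of the finite sum \<open>S\<^sub>n + R\<^sub>n\<close>, which is immediate for a subadditive \<open>T\<close> and the Aoki--Rolewicz
  argument with constant \<open>4\<close> for a quasi-additive one. If \<open>p1 = \<infinity>\<close> and the endpoint space is the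
  trivial \<open>L\<^sup>\<infinity>\<^sup>,\<^sup>1\<close>, the inclusion \<open>L\<^sup>p\<^sup>,\<^sup>r \<subseteq> W\<close> forces the measure to be finite, and then
  \<open>R\<^sub>n \<rightarrow> 0\<close> already in \<open>L\<^sup>p\<^sup>0\<^sup>,\<^sup>1\<close>.\<close>

section \<open>Powers and exponents in \<open>[0, \<infinity>]\<close>\<close>

lemma ennpow_one [simp]: "ennpow x 1 = x"
  by (cases x) (auto simp: ennpow_def)

lemma ennpow_mono: "x \<le> y \<Longrightarrow> 0 \<le> a \<Longrightarrow> ennpow x a \<le> ennpow y a"
  by (cases x; cases y) (auto simp: ennpow_def top_unique intro!: powr_mono2 ennreal_leI)

lemma ennpow_ennreal: "0 \<le> x \<Longrightarrow> ennpow (ennreal x) a = ennreal (x powr a)"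
  by (auto simp: ennpow_def)

lemma enn2real_recip_strict_antimono:
  fixes p q :: ennreal
  assumes "0 < p" "p < q"
  shows "enn2real (1 / q) < enn2real (1 / p)"
proof -
  from assms obtain x where x: "p = ennreal x" "0 < x"
    by (cases p) auto
  show ?thesis
  proof (cases q)
    case (real y)
    with assms x have "x < y" "0 < y" by (auto simp: ennreal_less_iff)
    then show ?thesis using x real
      by (simp add: divide_ennreal ennreal_1[symmetric] divide_strict_left_mono del: ennreal_1)
  next
    case top
    then show ?thesis using x
      by (simp add: divide_ennreal ennreal_1[symmetric] del: ennreal_1)
  qed
qed

lemma enn2real_recip:
  fixes r :: ennreal
  assumes "0 < r" "r < \<infinity>"
  shows "enn2real (1 / r) = 1 / enn2real r" "0 < enn2real r"
proof -
  from assms obtain x where "r = ennreal x" "0 < x"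
    by (cases r) auto
  then show "enn2real (1 / r) = 1 / enn2real r" "0 < enn2real r"
    by (simp_all add: divide_ennreal ennreal_1[symmetric] del: ennreal_1)
qed

section \<open>Rearrangements\<close>

lemma rearrangement_le:
  assumes "0 < s" "emeasure M {x \<in> space M. s < cmod (f x)} \<le> ennreal t"
  shows "rearrangement M f t \<le> ennreal s"
  unfolding rearrangement_def using assms by (intro INF_lower) auto

lemma rearrangement_ge:
  assumes f: "f \<in> borel_measurable M"
    and "ennreal t < emeasure M {x \<in> space M. s < cmod (f x)}"
  shows "ennreal s \<le> rearrangement M f t"
  unfolding rearrangement_def
proof (rule INF_greatest)
  fix u assume "u \<in> {s::real. 0 < s \<and> emeasure M {x \<in> space M. s < cmod (f x)} \<le> ennreal t}"
  then have u: "0 < u" "emeasure M {x \<in> space M. u < cmod (f x)} \<le> ennreal t" by auto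
  have "s \<le> u"
  proof (rule ccontr)
    assume "\<not> s \<le> u"
    with f have "emeasure M {x \<in> space M. s < cmod (f x)} \<le> emeasure M {x \<in> space M. u < cmod (f x)}"
      by (intro emeasure_mono) auto
    with u assms(2) show False by (meson leD order_trans)
  qed
  then show "ennreal s \<le> ennreal u" by (rule ennreal_leI)
qed

lemma emeasure_superlevel_le:
  assumes "f \<in> borel_measurable M" "rearrangement M f t < ennreal s"
  shows "emeasure M {x \<in> space M. s < cmod (f x)} \<le> ennreal t"
  using rearrangement_ge[OF assms(1)] assms(2) by (meson leD not_le)

lemma rearrangement_antimono:
  assumes "t \<le> u"
  shows "rearrangement M f u \<le> rearrangement M f t"
  unfolding rearrangement_def
  by (rule INF_superset_mono) (use assms in \<open>auto intro: order_trans[OF _ ennreal_leI]\<close>)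

lemma rearrangement_mono:
  assumes "f \<in> borel_measurable M" "\<And>x. x \<in> space M \<Longrightarrow> cmod (g x) \<le> cmod (f x)"
  shows "rearrangement M g t \<le> rearrangement M f t"
  unfolding rearrangement_def
proof (rule INF_superset_mono)
  show "{s. 0 < s \<and> emeasure M {x \<in> space M. s < cmod (f x)} \<le> ennreal t} \<subseteq>
        {s. 0 < s \<and> emeasure M {x \<in> space M. s < cmod (g x)} \<le> ennreal t}"
  proof safe
    fix s :: real assume "emeasure M {x \<in> space M. s < cmod (f x)} \<le> ennreal t"
    moreover have "emeasure M {x \<in> space M. s < cmod (g x)} \<le> emeasure M {x \<in> space M. s < cmod (f x)}"
      using assms by (intro emeasure_mono) (auto intro: less_le_trans)
    ultimately show "emeasure M {x \<in> space M. s < cmod (g x)} \<le> ennreal t" by simp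
  qed
qed simp

lemma rearrangement_eq_0:
  assumes "\<And>s. 0 < s \<Longrightarrow> emeasure M {x \<in> space M. s < cmod (f x)} \<le> ennreal t"
  shows "rearrangement M f t = 0"
proof -
  have "rearrangement M f t \<le> 0 + ennreal e" if "0 < e" for e
    using rearrangement_le[OF that assms[OF that]] by simp
  then have "rearrangement M f t \<le> 0" by (rule ennreal_le_epsilon) auto
  then show ?thesis by simp
qed

lemma rearrangement_zero [simp]: "rearrangement M (\<lambda>x. 0) t = 0"
  by (intro rearrangement_eq_0) simp

lemma rearrangement_uminus [simp]: "rearrangement M (\<lambda>x. - f x) t = rearrangement M f t"
  by (simp add: rearrangement_def)

lemma rearrangement_add:
  assumes f: "f \<in> borel_measurable M" and g: "g \<in> borel_measurable M"
    and "0 < s" "0 < s'" "0 \<le> t"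
    and "rearrangement M f t < ennreal s" "rearrangement M g t < ennreal s'"
  shows "rearrangement M (\<lambda>x. f x + g x) (2 * t) \<le> ennreal (s + s')"
proof (rule rearrangement_le)
  have "emeasure M {x \<in> space M. s + s' < cmod (f x + g x)}
      \<le> emeasure M ({x \<in> space M. s < cmod (f x)} \<union> {x \<in> space M. s' < cmod (g x)})"
  proof (intro emeasure_mono subsetI)
    fix x assume "x \<in> {x \<in> space M. s + s' < cmod (f x + g x)}"
    then show "x \<in> {x \<in> space M. s < cmod (f x)} \<union> {x \<in> space M. s' < cmod (g x)}"
      using norm_triangle_ineq[of "f x" "g x"] by auto
  qed (use f g in measurable)
  also have "\<dots> \<le> emeasure M {x \<in> space M. s < cmod (f x)} + emeasure M {x \<in> space M. s' < cmod (g x)}"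
    using f g by (intro emeasure_subadditive) auto
  also have "\<dots> \<le> ennreal t + ennreal t"
    using assms by (intro add_mono emeasure_superlevel_le)
  also have "\<dots> = ennreal (2 * t)" using \<open>0 \<le> t\<close> by (simp flip: ennreal_plus)
  finally show "emeasure M {x \<in> space M. s + s' < cmod (f x + g x)} \<le> ennreal (2 * t)" .
qed (use assms in auto)

section \<open>Weak-type bounds\<close>

text \<open>For \<open>a = 1 / p\<close> this says that \<open>f\<close> has norm at most \<open>A\<close> in the space \<open>L\<^sup>p\<^sup>,\<^sup>\<infinity>\<close>.\<close>

definition weak_bound :: "'a measure \<Rightarrow> real \<Rightarrow> real \<Rightarrow> ('a \<Rightarrow> complex) \<Rightarrow> bool" where
  "weak_bound M a A f \<longleftrightarrow> (\<forall>t>0. rearrangement M f t \<le> ennreal (A * t powr (- a)))"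

definition weak_space :: "'a measure \<Rightarrow> real \<Rightarrow> ('a \<Rightarrow> complex) set" where
  "weak_space M a = {f \<in> borel_measurable M. \<exists>A>0. weak_bound M a A f}"

lemma weak_space_add:
  assumes "f \<in> weak_space M a" "g \<in> weak_space M a"
  shows "(\<lambda>x. f x + g x) \<in> weak_space M a"
proof -
  from assms obtain A B where AB: "0 < A" "weak_bound M a A f" "0 < B" "weak_bound M a B g"
    and m: "f \<in> borel_measurable M" "g \<in> borel_measurable M"
    by (auto simp: weak_space_def)
  have "weak_bound M a ((2 * A + 2 * B) * 2 powr a) (\<lambda>x. f x + g x)"
    unfolding weak_bound_def
  proof (intro allI impI)
    fix t :: real assume t: "0 < t"
    let ?u = "(t / 2) powr (- a)"
    have u: "0 < ?u" using t by simp
    have "rearrangement M f (t/2) \<le> ennreal (A * ?u)" "rearrangement M g (t/2) \<le> ennreal (B * ?u)"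
      using AB t by (auto simp: weak_bound_def)
    moreover have "ennreal (A * ?u) < ennreal (2 * A * ?u)" "ennreal (B * ?u) < ennreal (2 * B * ?u)"
      using AB u by (auto simp: ennreal_less_iff)
    ultimately have "rearrangement M (\<lambda>x. f x + g x) (2 * (t/2)) \<le> ennreal (2 * A * ?u + 2 * B * ?u)"
      using AB u t m by (intro rearrangement_add) auto
    also have "2 * A * ?u + 2 * B * ?u = (2 * A + 2 * B) * 2 powr a * t powr (- a)"
      using t by (simp add: powr_divide powr_minus field_simps)
    finally show "rearrangement M (\<lambda>x. f x + g x) t
        \<le> ennreal ((2 * A + 2 * B) * 2 powr a * t powr (- a))" by simp
  qed
  moreover have "0 < (2 * A + 2 * B) * 2 powr a" using AB by simp
  ultimately show ?thesis using m by (auto simp: weak_space_def)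
qed

lemma weak_space_zero: "(\<lambda>x. 0) \<in> weak_space M a"
  by (auto simp: weak_space_def weak_bound_def intro: exI[of _ 1])

lemma weak_space_uminus: "f \<in> weak_space M a \<Longrightarrow> (\<lambda>x. - f x) \<in> weak_space M a"
  by (auto simp: weak_space_def weak_bound_def)

lemma weak_space_sum:
  "(\<And>j. j \<in> A \<Longrightarrow> F j \<in> weak_space M a) \<Longrightarrow> (\<lambda>x. \<Sum>j\<in>A. F j x) \<in> weak_space M a"
  by (induction A rule: infinite_finite_induct) (auto intro: weak_space_zero weak_space_add)

lemma lorentz_norm_1:
  "lorentz_norm M p 1 f =
    (\<integral>\<^sup>+t. ennreal (t powr enn2real (1 / p)) * rearrangement M f t * ennreal (1 / t) * indicator {0<..} t \<partial>lborel)"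
  by (simp add: lorentz_norm_def)

lemma lorentz_norm_zero: "0 < q \<Longrightarrow> lorentz_norm M p q (\<lambda>x. 0) = 0"
  by (auto simp: lorentz_norm_def ennpow_def)

lemma zero_in_lorentz_space: "0 < q \<Longrightarrow> (\<lambda>x. 0) \<in> lorentz_space M p q"
  by (simp add: lorentz_space_def lorentz_norm_zero)

lemma weak_bound_of_lorentz_norm:
  assumes "0 < r" "0 < d" "lorentz_norm M p r f \<le> ennreal d"
  shows "weak_bound M (enn2real (1 / p)) (2 powr (1 / enn2real r + enn2real (1 / p)) * d) f"
  unfolding weak_bound_def
proof (intro allI impI)
  fix t :: real assume t: "0 < t"
  define a where "a = enn2real (1 / p)"
  have a: "0 \<le> a" by (simp add: a_def)
  have key: "ennreal ((t / 2) powr a) * rearrangement M f t \<le> ennreal (2 powr (1 / enn2real r) * d)"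
  proof (cases "r = \<infinity>")
    case True
    have "ennreal ((t / 2) powr a) * rearrangement M f t \<le> ennreal (t powr a) * rearrangement M f t"
      using t a by (intro mult_right_mono ennreal_leI powr_mono2) auto
    also have "\<dots> \<le> lorentz_norm M p r f"
      using t True by (auto simp: lorentz_norm_def a_def intro!: SUP_upper)
    also note assms(3)
    finally show ?thesis using True by simp
  next
    case False
    define c where "c = enn2real r"
    have c: "0 < c" "enn2real (1 / r) = 1 / c"
      using enn2real_recip[of r] assms False by (auto simp: c_def less_top)
    define X where "X = ennreal ((t / 2) powr a) * rearrangement M f t"
    have "ennpow X c * ennreal (1 / 2) = ennpow X c * ennreal (1 / t) * ennreal (t / 2)"
      using t by (simp add: mult.assoc flip: ennreal_mult)
    also have "\<dots> = (\<integral>\<^sup>+u. ennpow X c * ennreal (1 / t) * indicator {t/2..t} u \<partial>lborel)"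
      using t by (subst nn_integral_cmult_indicator) auto
    also have "\<dots> \<le> (\<integral>\<^sup>+u\<in>{0<..}. (ennpow (ennreal (u powr a) * rearrangement M f u) c * ennreal (1 / u)) \<partial>lborel)"
    proof (intro nn_integral_mono)
      fix u :: real
      show "ennpow X c * ennreal (1 / t) * indicator {t/2..t} u
        \<le> ennpow (ennreal (u powr a) * rearrangement M f u) c * ennreal (1 / u) * indicator {0<..} u"
      proof (cases "u \<in> {t/2..t}")
        case True
        then have "ennpow X c * ennreal (1 / t) \<le> ennpow (ennreal (u powr a) * rearrangement M f u) c * ennreal (1 / u)"
          unfolding X_def using t a c
          by (intro mult_mono ennpow_mono ennreal_leI rearrangement_antimono powr_mono2)
             (auto simp: field_simps)
        with True t show ?thesis by (auto simp: indicator_def)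
      qed auto
    qed
    finally have "ennpow (ennpow X c * ennreal (1 / 2)) (1 / c) \<le> lorentz_norm M p r f"
      using False c unfolding lorentz_norm_def
      by (auto simp flip: a_def c_def intro!: ennpow_mono)
    also note assms(3)
    finally have le: "ennpow (ennpow X c * ennreal (1 / 2)) (1 / c) \<le> ennreal d" .
    have "X \<noteq> top"
    proof
      assume "X = top"
      then have "ennpow (ennpow X c * ennreal (1 / 2)) (1 / c) = top"
        by (simp add: ennpow_def ennreal_top_mult)
      with le show False by (simp add: top_unique)
    qed
    then obtain x where x: "X = ennreal x" "0 \<le> x" by (cases X) auto
    have "ennpow X c * ennreal (1 / 2) = ennreal (x powr c / 2)"
      using x ennreal_mult[of "x powr c" "1 / 2"] by (simp add: ennpow_ennreal)
    with le have "ennreal ((x powr c / 2) powr (1 / c)) \<le> ennreal d"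
      by (simp add: ennpow_ennreal)
    then have "(x powr c / 2) powr (1 / c) \<le> d"
      using assms(2) by (simp add: ennreal_le_iff)
    also have "(x powr c / 2) powr (1 / c) = x / 2 powr (1 / c)"
      using x c by (simp add: powr_divide powr_powr)
    finally have "x \<le> 2 powr (1 / c) * d" by (simp add: field_simps)
    then show ?thesis using x by (simp add: c_def X_def ennreal_leI)
  qed
  have "rearrangement M f t = ennreal ((t / 2) powr (- a)) * (ennreal ((t / 2) powr a) * rearrangement M f t)"
    using t by (simp add: powr_minus_divide mult.assoc[symmetric] flip: ennreal_mult)
  also have "\<dots> \<le> ennreal ((t / 2) powr (- a)) * ennreal (2 powr (1 / enn2real r) * d)"
    by (intro mult_left_mono key) simp
  also have "\<dots> = ennreal (2 powr (1 / enn2real r + a) * d * t powr (- a))"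
    using t assms(2) by (simp add: powr_divide powr_minus powr_add field_simps flip: ennreal_mult)
  finally show "rearrangement M f t \<le> ennreal (2 powr (1 / enn2real r + enn2real (1 / p)) * d * t powr (- enn2real (1 / p)))"
    by (simp add: a_def)
qed

lemma lorentz_space_subset_weak_space:
  assumes "0 < r"
  shows "lorentz_space M p r \<subseteq> weak_space M (enn2real (1 / p))"
proof
  fix f assume f: "f \<in> lorentz_space M p r"
  then have "lorentz_norm M p r f \<le> ennreal (enn2real (lorentz_norm M p r f) + 1)"
    by (auto simp: lorentz_space_def intro: order_trans[OF _ ennreal_leI[of "enn2real (lorentz_norm M p r f)"]])
  from weak_bound_of_lorentz_norm[OF assms _ this] obtain A
    where "0 < A" "weak_bound M (enn2real (1 / p)) A f"
    by (metis add_nonneg_pos enn2real_nonneg mult_pos_pos powr_gt_zero zero_less_numeral zero_less_one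
        zero_neq_numeral)
  with f show "f \<in> weak_space M (enn2real (1 / p))"
    by (auto simp: lorentz_space_def weak_space_def)
qed

section \<open>Splitting between the endpoint spaces\<close>

lemma nn_integral_powr_from_0:
  fixes c e :: real
  assumes "- 1 < e" "0 \<le> c"
  shows "(\<integral>\<^sup>+t. ennreal (t powr e) * indicator {0<..c} t \<partial>lborel) = ennreal (c powr (e + 1) / (e + 1))"
proof -
  have "(\<integral>\<^sup>+t. ennreal (t powr e) * indicator {0<..c} t \<partial>lborel)
      = (\<integral>\<^sup>+t. ennreal (t powr e) * indicator {0..c} t \<partial>lborel)"
    by (intro nn_integral_cong) (auto simp: indicator_def)
  also have "\<dots> = ennreal (c powr (e + 1) / (e + 1))"
    using has_integral_powr_from_0[OF assms] by (intro nn_integral_has_integral_lebesgue') auto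
  finally show ?thesis .
qed

lemma nn_integral_powr_to_inf:
  fixes e :: real
  assumes "e < - 1"
  shows "(\<integral>\<^sup>+t. ennreal (t powr e) * indicator {1..} t \<partial>lborel) = ennreal (- 1 / (e + 1))"
  using has_integral_powr_to_inf[OF assms, of 1] by (intro nn_integral_has_integral_lebesgue') auto

lemma lorentz_norm_1_le:
  assumes "b < enn2real (1 / p)" "0 \<le> A" "0 \<le> c"
    and "\<And>t. 0 < t \<Longrightarrow> t \<le> c \<Longrightarrow> rearrangement M g t \<le> ennreal (A * t powr (- b))"
    and "\<And>t. c < t \<Longrightarrow> rearrangement M g t = 0"
  shows "lorentz_norm M p 1 g \<le> ennreal (A * (c powr (enn2real (1 / p) - b) / (enn2real (1 / p) - b)))"
proof -
  define a where "a = enn2real (1 / p)"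
  have "lorentz_norm M p 1 g
      \<le> (\<integral>\<^sup>+t. ennreal A * (ennreal (t powr (a - b - 1)) * indicator {0<..c} t) \<partial>lborel)"
    unfolding lorentz_norm_1 a_def[symmetric]
  proof (intro nn_integral_mono)
    fix t :: real
    consider "t \<le> 0" | "c < t" | "0 < t" "t \<le> c" by linarith
    then show "ennreal (t powr a) * rearrangement M g t * ennreal (1 / t) * indicator {0<..} t
      \<le> ennreal A * (ennreal (t powr (a - b - 1)) * indicator {0<..c} t)"
    proof cases
      case 3
      have "ennreal (t powr a) * rearrangement M g t * ennreal (1 / t)
          \<le> ennreal (t powr a) * ennreal (A * t powr (- b)) * ennreal (1 / t)"
        using 3 assms by (intro mult_right_mono mult_left_mono) auto
      also have "\<dots> = ennreal (A * t powr (a - b - 1))"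
        using 3 assms by (simp add: powr_diff powr_minus powr_add field_simps flip: ennreal_mult)
      finally show ?thesis using 3 assms by (simp add: ennreal_mult)
    qed (use assms(5) in auto)
  qed
  also have "\<dots> = ennreal A * ennreal (c powr (a - b) / (a - b))"
    using assms by (subst nn_integral_cmult) (auto simp: nn_integral_powr_from_0 a_def)
  also have "\<dots> = ennreal (A * (c powr (a - b) / (a - b)))"
    using assms by (intro ennreal_mult[symmetric]) (auto simp: a_def)
  finally show ?thesis by (simp add: a_def)
qed

lemma lorentz_norm_le_of_min:
  assumes "0 < r" "r < \<infinity>" "0 < enn2real (1 / p)" "enn2real (1 / p) < b" "0 \<le> A"
    and h: "\<And>t. 0 < t \<Longrightarrow> rearrangement M h t \<le> ennreal A"
      "weak_bound M b A h"
  defines "a \<equiv> enn2real (1 / p)" and "c \<equiv> enn2real r"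
  shows "lorentz_norm M p r h \<le> ennreal ((A powr c * (1 / (a * c) + 1 / ((b - a) * c))) powr (1 / c))"
proof -
  have c: "0 < c" "enn2real (1 / r) = 1 / c"
    using enn2real_recip[OF assms(1,2)] by (auto simp: c_def)
  have ac: "0 < a * c" "0 < (b - a) * c" using assms c by auto
  define I where "I = (\<integral>\<^sup>+t\<in>{0<..}. (ennpow (ennreal (t powr a) * rearrangement M h t) c * ennreal (1 / t)) \<partial>lborel)"
  have pw: "ennpow (ennreal (t powr a) * rearrangement M h t) c * ennreal (1 / t)
      \<le> ennreal (A powr c) * ennreal (t powr ((a - d) * c - 1))"
    if t: "0 < t" and le: "rearrangement M h t \<le> ennreal (A * t powr (- d))" for t d
  proof -
    have "ennpow (ennreal (t powr a) * rearrangement M h t) c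
        \<le> ennpow (ennreal (t powr a) * ennreal (A * t powr (- d))) c"
      using c by (intro ennpow_mono mult_left_mono le) auto
    also have "\<dots> = ennreal ((A * t powr (a - d)) powr c)"
      using t assms by (simp add: ennpow_ennreal powr_diff powr_minus field_simps flip: ennreal_mult)
    also have "\<dots> = ennreal (A powr c * t powr ((a - d) * c))"
      using t assms by (simp add: powr_mult powr_powr)
    finally have "ennpow (ennreal (t powr a) * rearrangement M h t) c * ennreal (1 / t)
        \<le> ennreal (A powr c * t powr ((a - d) * c)) * ennreal (1 / t)"
      by (rule mult_right_mono) simp
    also have "\<dots> = ennreal (A powr c) * ennreal (t powr ((a - d) * c - 1))"
      using t by (simp add: powr_diff flip: ennreal_mult)
    finally show ?thesis .
  qed
  have "I \<le> (\<integral>\<^sup>+t. ennreal (A powr c) * (ennreal (t powr (a * c - 1)) * indicator {0<..1} t)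
        + ennreal (A powr c) * (ennreal (t powr ((a - b) * c - 1)) * indicator {1..} t) \<partial>lborel)"
    unfolding I_def
  proof (intro nn_integral_mono)
    fix t :: real
    consider "t \<le> 0" | "0 < t" "t \<le> 1" | "1 < t" by linarith
    then show "ennpow (ennreal (t powr a) * rearrangement M h t) c * ennreal (1 / t) * indicator {0<..} t
      \<le> ennreal (A powr c) * (ennreal (t powr (a * c - 1)) * indicator {0<..1} t)
        + ennreal (A powr c) * (ennreal (t powr ((a - b) * c - 1)) * indicator {1..} t)"
    proof cases
      case 2
      with pw[of t 0] h(1)[of t] show ?thesis by (auto intro: add_increasing2)
    next
      case 3
      with pw[of t b] h(2) show ?thesis by (auto simp: weak_bound_def)
    qed auto
  qed
  also have "\<dots> = ennreal (A powr c) * ennreal (1 / (a * c))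
      + ennreal (A powr c) * ennreal (- 1 / ((a - b) * c))"
  proof -
    have "(a - b) * c - 1 < - 1" using ac by (simp add: algebra_simps)
    from nn_integral_powr_to_inf[OF this] nn_integral_powr_from_0[of "a * c - 1" 1] ac
    show ?thesis by (simp add: nn_integral_add nn_integral_cmult)
  qed
  also have "- 1 / ((a - b) * c) = 1 / ((b - a) * c)"
    using minus_divide_right[of 1 "(a - b) * c"] by (simp flip: mult_minus_left)
  also have "ennreal (A powr c) * ennreal (1 / (a * c)) + ennreal (A powr c) * ennreal (1 / ((b - a) * c))
      = ennreal (A powr c * (1 / (a * c) + 1 / ((b - a) * c)))"
  proof -
    have nn: "0 \<le> 1 / (a * c)" "0 \<le> 1 / ((b - a) * c)"
      using ac by (simp_all only: zero_le_divide_1_iff less_imp_le)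
    then show ?thesis
      by (simp only: distrib_left[symmetric] ennreal_plus[symmetric] ennreal_mult[OF powr_ge_zero] add_nonneg_nonneg)
  qed
  finally have "ennpow I (1 / c) \<le> ennpow (ennreal (A powr c * (1 / (a * c) + 1 / ((b - a) * c)))) (1 / c)"
    using c by (intro ennpow_mono) auto
  then show ?thesis
    using assms(2) ac c by (auto simp: lorentz_norm_def I_def ennpow_ennreal simp flip: c_def a_def)
qed

text \<open>The two pieces are cut at the level that \<open>f\<close> exceeds on a set of measure at most \<open>1\<close>, so that
  all bounds are linear in the size of \<open>f\<close>.\<close>

lemma weak_bound_split:
  assumes f: "f \<in> borel_measurable M" "weak_bound M a d f" "0 < d"
    and a: "enn2real (1 / p1) < a" "a < enn2real (1 / p0)"
    and s: "s = 1 \<and> 0 < enn2real (1 / p1) \<or> p1 = \<infinity> \<and> s = \<infinity>"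
  defines "C \<equiv> 1 / (enn2real (1 / p0) - a) + 2 + 2 * (1 / enn2real (1 / p1) + 1 / (a - enn2real (1 / p1)))"
  obtains g h where "f = (\<lambda>x. g x + h x)" "g \<in> borel_measurable M" "h \<in> borel_measurable M"
    "lorentz_norm M p0 1 g \<le> ennreal (C * d)" "lorentz_norm M p1 s h \<le> ennreal (C * d)"
proof
  let ?g = "\<lambda>x. if 2 * d < cmod (f x) then f x else 0"
  let ?h = "\<lambda>x. if 2 * d < cmod (f x) then 0 else f x"
  have a1: "0 \<le> enn2real (1 / p1)" by simp
  note [measurable] = f(1)
  show "f = (\<lambda>x. ?g x + ?h x)" by auto
  show "?g \<in> borel_measurable M" "?h \<in> borel_measurable M" by measurable
  have fb: "rearrangement M f t \<le> ennreal (d * t powr - a)" if "0 < t" for t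
    using f that by (auto simp: weak_bound_def)
  have "lorentz_norm M p0 1 ?g \<le> ennreal (d * (1 powr (enn2real (1 / p0) - a) / (enn2real (1 / p0) - a)))"
  proof (rule lorentz_norm_1_le)
    fix t :: real assume "0 < t"
    have "rearrangement M ?g t \<le> rearrangement M f t"
      by (intro rearrangement_mono) auto
    also note fb[OF \<open>0 < t\<close>]
    finally show "rearrangement M ?g t \<le> ennreal (d * t powr - a)" .
  next
    fix t :: real assume t: "1 < t"
    show "rearrangement M ?g t = 0"
    proof (rule rearrangement_eq_0)
      fix u :: real assume "0 < u"
      have "rearrangement M f 1 < ennreal (2 * d)"
        using fb[of 1] f(3) by (auto simp: ennreal_less_iff intro: le_less_trans)
      then have "emeasure M {x \<in> space M. 2 * d < cmod (f x)} \<le> ennreal 1"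
        by (intro emeasure_superlevel_le f)
      moreover have "emeasure M {x \<in> space M. u < cmod (?g x)} \<le> emeasure M {x \<in> space M. 2 * d < cmod (f x)}"
        using \<open>0 < u\<close> by (intro emeasure_mono) (auto split: if_splits)
      moreover have "ennreal 1 \<le> ennreal t" using t by (intro ennreal_leI) simp
      ultimately show "emeasure M {x \<in> space M. u < cmod (?g x)} \<le> ennreal t"
        by (meson order_trans)
    qed
  qed (use a f in auto)
  also have "\<dots> \<le> ennreal (C * d)"
  proof (rule ennreal_leI)
    have "0 \<le> d * (2 + 2 * (1 / enn2real (1 / p1) + 1 / (a - enn2real (1 / p1))))"
      using a f a1 by (intro mult_nonneg_nonneg add_nonneg_nonneg) auto
    then show "d * (1 powr (enn2real (1 / p0) - a) / (enn2real (1 / p0) - a)) \<le> C * d"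
      by (simp add: C_def algebra_simps)
  qed
  finally show "lorentz_norm M p0 1 ?g \<le> ennreal (C * d)" .
  have hb: "rearrangement M ?h t \<le> ennreal (2 * d)" if "0 < t" for t
    using f that by (intro rearrangement_le) (auto simp: not_less)
  have pos: "0 \<le> d * (1 / (enn2real (1 / p0) - a))" "0 \<le> d * (1 / enn2real (1 / p1) + 1 / (a - enn2real (1 / p1)))"
    using a f a1 by simp_all
  have Cd: "C * d = d * (1 / (enn2real (1 / p0) - a)) + 2 * d
      + 2 * d * (1 / enn2real (1 / p1) + 1 / (a - enn2real (1 / p1)))"
    unfolding C_def by (simp only: algebra_simps)
  show "lorentz_norm M p1 s ?h \<le> ennreal (C * d)"
    using s
  proof
    assume s: "s = 1 \<and> 0 < enn2real (1 / p1)"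
    have "weak_bound M a (2 * d) ?h"
      unfolding weak_bound_def
    proof (intro allI impI)
      fix t :: real assume "0 < t"
      have "rearrangement M ?h t \<le> rearrangement M f t"
        by (intro rearrangement_mono) auto
      also note fb[OF \<open>0 < t\<close>]
      also have "ennreal (d * t powr - a) \<le> ennreal (2 * d * t powr - a)"
        using f by (intro ennreal_leI mult_right_mono) auto
      finally show "rearrangement M ?h t \<le> ennreal (2 * d * t powr - a)" .
    qed
    with s a f hb have "lorentz_norm M p1 s ?h
        \<le> ennreal (2 * d * (1 / enn2real (1 / p1) + 1 / (a - enn2real (1 / p1))))"
      using lorentz_norm_le_of_min[of 1 p1 a "2 * d" M ?h] pos by simp
    also have "\<dots> \<le> ennreal (C * d)"
      using pos f Cd by (intro ennreal_leI) linarith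
    finally show ?thesis .
  next
    assume s: "p1 = \<infinity> \<and> s = \<infinity>"
    then have "lorentz_norm M p1 s ?h \<le> ennreal (2 * d)"
      using hb by (auto simp: lorentz_norm_def intro!: SUP_least)
    also have "\<dots> \<le> ennreal (C * d)"
      using pos f Cd by (intro ennreal_leI) linarith
    finally show ?thesis .
  qed
qed

lemma lorentz_infinity_1_rearrangement:
  assumes "lorentz_norm M \<infinity> 1 h < \<infinity>" "0 < t"
  shows "rearrangement M h t = 0"
proof -
  obtain B where B: "lorentz_norm M \<infinity> 1 h = ennreal B" "0 \<le> B"
    using assms(1) by (cases "lorentz_norm M \<infinity> 1 h") auto
  have le: "rearrangement M h t * ennreal (1 / e) \<le> ennreal B" if e: "0 < e" for e
  proof -
    have "rearrangement M h t * ennreal (1 / e)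
        = rearrangement M h t * ennreal (t powr - e) * ennreal (t powr (e - 1 + 1) / (e - 1 + 1))"
      using e assms by (simp add: powr_minus mult.assoc field_simps flip: ennreal_mult)
    also have "\<dots> = (\<integral>\<^sup>+u. rearrangement M h t * ennreal (t powr - e) * (ennreal (u powr (e - 1)) * indicator {0<..t} u) \<partial>lborel)"
      using e assms(2) by (subst nn_integral_cmult) (auto simp: nn_integral_powr_from_0)
    also have "\<dots> \<le> lorentz_norm M \<infinity> 1 h"
      unfolding lorentz_norm_1
    proof (intro nn_integral_mono)
      fix u :: real
      show "rearrangement M h t * ennreal (t powr - e) * (ennreal (u powr (e - 1)) * indicator {0<..t} u)
        \<le> ennreal (u powr enn2real (1 / \<infinity>)) * rearrangement M h u * ennreal (1 / u) * indicator {0<..} u"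
      proof (cases "0 < u \<and> u \<le> t")
        case True
        have "t powr - e * u powr (e - 1) = (u / t) powr e * (1 / u)"
          using True by (simp add: powr_minus powr_diff powr_divide field_simps)
        also have "\<dots> \<le> 1 * (1 / u)"
          using True e by (intro mult_right_mono powr_le1) auto
        finally have "t powr - e * u powr (e - 1) \<le> 1 / u" by simp
        then have "rearrangement M h t * ennreal (t powr - e * u powr (e - 1))
            \<le> rearrangement M h u * ennreal (1 / u)"
          using True by (intro mult_mono rearrangement_antimono ennreal_leI) auto
        then show ?thesis using True by (simp add: ennreal_mult mult.assoc)
      qed (auto simp: indicator_def)
    qed
    finally show ?thesis using B by simp
  qed
  show ?thesis
  proof (cases "rearrangement M h t")
    case (real x)
    have "x = 0"
    proof (rule ccontr)
      assume "x \<noteq> 0"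
      then have "0 < x" using real by simp
      then have "0 < x / (B + 1)" using B by simp
      from le[OF this] real \<open>0 < x\<close> have "ennreal (B + 1) \<le> ennreal B"
        using B by (simp flip: ennreal_mult)
      then show False using B by (simp add: ennreal_le_iff)
    qed
    then show ?thesis using real by simp
  next
    case top
    then show ?thesis using le[of 1] by (simp add: top_unique)
  qed
qed

text \<open>On an infinite measure space exhausted by sets \<open>A n\<close> of finite measure \<open>m n\<close>, the function
  \<open>x \<mapsto> m n powr (- b)\<close>, with \<open>n\<close> the first index such that \<open>x \<in> A n\<close>, decays like \<open>t powr (- b)\<close>.
  For \<open>1 / p < b < 1 / p0\<close> this separates the two spaces.\<close>

lemma finite_measure_of_lorentz_subset:
  assumes sf: "sigma_finite_measure M" and "0 < r"
    and p: "0 < enn2real (1 / p)" "enn2real (1 / p) < enn2real (1 / p0)"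
    and sub: "lorentz_space M p r \<subseteq> space_sum (lorentz_space M p0 1) (lorentz_space M \<infinity> 1)"
  shows "emeasure M (space M) < \<infinity>"
proof (rule ccontr)
  assume "\<not> emeasure M (space M) < \<infinity>"
  then have inf: "emeasure M (space M) = \<infinity>" by (simp add: not_less top_unique)
  define a where "a = enn2real (1 / p)"
  define a0 where "a0 = enn2real (1 / p0)"
  define b where "b = (a + a0) / 2"
  have ab: "0 < a" "a < b" "b < a0" using p by (auto simp: a_def a0_def b_def)
  obtain A' :: "nat \<Rightarrow> 'a set" where A': "range A' \<subseteq> sets M" "(\<Union>i. A' i) = space M"
      "\<And>i. emeasure M (A' i) \<noteq> \<infinity>" "incseq A'"
    using sigma_finite_measure.sigma_finite_incseq[OF sf] by blast
  have unb: "\<exists>n. ennreal c < emeasure M (A' n)" for c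
  proof -
    have "(SUP n. emeasure M (A' n)) = top"
      using SUP_emeasure_incseq[OF A'(1,4)] A'(2) inf by simp
    then show ?thesis by (metis ennreal_less_top less_SUP_iff)
  qed
  obtain n0 where n0: "ennreal 1 < emeasure M (A' n0)" using unb by blast
  define A where "A n = A' (n + n0)" for n
  define m where "m n = measure M (A n)" for n
  have A: "A n \<in> sets M" "emeasure M (A n) = ennreal (m n)" for n
    using A' by (auto simp: A_def m_def emeasure_eq_ennreal_measure)
  have A_mono: "A i \<subseteq> A j" if "i \<le> j" for i j
    using A'(4) that by (auto simp: A_def incseq_def)
  have A_un: "\<exists>n. x \<in> A n" if x: "x \<in> space M" for x
  proof -
    obtain i where "x \<in> A' i" using A'(2) x by blast
    then have "x \<in> A i" using incseqD[OF A'(4), of i "i + n0"] by (auto simp: A_def)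
    then show ?thesis ..
  qed
  have m_mono: "m i \<le> m j" if "i \<le> j" for i j
  proof -
    have "ennreal (m i) \<le> ennreal (m j)"
      unfolding A(2)[symmetric] by (intro emeasure_mono A_mono that A(1))
    then show ?thesis by (simp add: ennreal_le_iff m_def)
  qed
  have m1: "1 < m n" for n
  proof -
    have "ennreal 1 < ennreal (m 0)" using n0 A(2)[of 0] by (simp add: A_def)
    then show ?thesis using m_mono[of 0 n] by (simp add: ennreal_less_iff)
  qed
  have m_unb: "\<exists>n. c < m n" for c
  proof -
    obtain n where n: "ennreal \<bar>c\<bar> < emeasure M (A' n)" using unb by blast
    also have "\<dots> \<le> emeasure M (A n)"
      using A' by (intro emeasure_mono) (auto simp: A_def incseqD)
    finally have "\<bar>c\<bar> < m n" using A(2)[of n] by (simp add: ennreal_less_iff)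
    then show ?thesis by (intro exI[of _ n]) simp
  qed
  define N where "N x = (LEAST n. x \<in> A n)" for x
  have N: "x \<in> A (N x)" if "x \<in> space M" for x
    unfolding N_def using A_un[OF that] by (rule LeastI_ex)
  have N_le: "N x \<le> n" if "x \<in> A n" for x n
    unfolding N_def using that by (rule Least_le)
  define f where "f x = complex_of_real (m (N x) powr - b)" for x
  have N_meas: "N \<in> measurable M (count_space UNIV)"
    unfolding N_def using A(1) by measurable
  have f_meas: "f \<in> borel_measurable M"
    unfolding f_def by (rule measurable_compose[OF N_meas]) simp
  have cf: "cmod (f x) = m (N x) powr - b" for x
    by (simp add: f_def)
  have f_le1: "rearrangement M f t \<le> ennreal 1" if "0 < t" for t
  proof (rule rearrangement_le)
    have "{x \<in> space M. 1 < cmod (f x)} = {}"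
      using m1 ab by (auto simp: cf not_less powr_minus intro!: ge_one_powr_ge_zero less_imp_le simp: inverse_le_1_iff)
    then show "emeasure M {x \<in> space M. 1 < cmod (f x)} \<le> ennreal t" by (simp only: emeasure_empty zero_le)
  qed simp
  have f_weak: "weak_bound M b 1 f"
    unfolding weak_bound_def
  proof (intro allI impI)
    fix t :: real assume t: "0 < t"
    define n where "n = (LEAST n. t < m n)"
    have n: "t < m n" unfolding n_def using m_unb by (rule LeastI_ex)
    have lt: "cmod (f x) < t powr - b" if "n \<le> N x" for x
    proof -
      have "t < m (N x)" using n m_mono[OF that] by simp
      then show ?thesis using t ab by (simp add: cf powr_less_mono2_neg)
    qed
    have "emeasure M {x \<in> space M. t powr - b < cmod (f x)} \<le> ennreal t"
    proof (cases n)
      case 0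
      then have "\<not> t powr - b < cmod (f x)" for x using lt[of x] by simp
      then have "{x \<in> space M. t powr - b < cmod (f x)} = {}" by simp
      then show ?thesis by (simp only: emeasure_empty zero_le)
    next
      case (Suc k)
      have "{x \<in> space M. t powr - b < cmod (f x)} \<subseteq> A k"
      proof safe
        fix x assume x: "x \<in> space M" "t powr - b < cmod (f x)"
        then have "\<not> n \<le> N x" using lt[of x] by auto
        then have "N x \<le> k" using Suc by simp
        then show "x \<in> A k" using N[OF x(1)] A_mono by blast
      qed
      then have "emeasure M {x \<in> space M. t powr - b < cmod (f x)} \<le> ennreal (m k)"
        using A emeasure_mono by metis
      also have "m k \<le> t"
        using not_less_Least[of k "\<lambda>n. t < m n"] Suc by (simp add: n_def)
      finally show ?thesis by (simp add: ennreal_leI)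
    qed
    then show "rearrangement M f t \<le> ennreal (1 * t powr - b)"
      using t by (intro rearrangement_le) auto
  qed
  have "lorentz_norm M p r f < \<infinity>"
  proof (cases "r = \<infinity>")
    case True
    have "ennreal (t powr a) * rearrangement M f t \<le> ennreal 1" if t: "0 < t" for t
    proof (cases "t \<le> 1")
      case True
      have "ennreal (t powr a) * rearrangement M f t \<le> ennreal 1 * ennreal 1"
        using True t ab by (intro mult_mono f_le1 ennreal_leI powr_le1) auto
      then show ?thesis by simp
    next
      case False
      have "ennreal (t powr a) * rearrangement M f t \<le> ennreal (t powr a) * ennreal (1 * t powr - b)"
        using f_weak t by (intro mult_left_mono) (auto simp: weak_bound_def)
      also have "\<dots> = ennreal (t powr (a - b))"
        by (simp add: powr_diff powr_minus field_simps flip: ennreal_mult)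
      also have "\<dots> \<le> ennreal (t powr 0)"
        using False ab by (intro ennreal_leI powr_mono) auto
      finally show ?thesis using t by simp
    qed
    then have "lorentz_norm M p r f \<le> ennreal 1"
      using True by (auto simp: lorentz_norm_def simp flip: a_def intro!: SUP_least)
    then show ?thesis by (rule le_less_trans) simp
  next
    case False
    have "lorentz_norm M p r f
        \<le> ennreal ((1 powr enn2real r * (1 / (enn2real (1 / p) * enn2real r)
            + 1 / ((b - enn2real (1 / p)) * enn2real r))) powr (1 / enn2real r))"
      using False assms(2) ab f_le1 f_weak
      by (intro lorentz_norm_le_of_min) (auto simp: less_top simp flip: a_def)
    then show ?thesis by (rule le_less_trans) simp
  qed
  then have "f \<in> space_sum (lorentz_space M p0 1) (lorentz_space M \<infinity> 1)"
    using sub f_meas by (auto simp: lorentz_space_def)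
  then obtain g h where gh: "f = (\<lambda>x. g x + h x)" "g \<in> lorentz_space M p0 1" "h \<in> lorentz_space M \<infinity> 1"
    by (auto simp: space_sum_def)
  have "h \<in> weak_space M a0"
    using gh(3) lorentz_infinity_1_rearrangement[of M h]
    by (auto simp: lorentz_space_def weak_space_def weak_bound_def intro!: exI[of _ 1])
  moreover have "g \<in> weak_space M a0"
    using lorentz_space_subset_weak_space[of 1 M p0] gh by (auto simp: a0_def)
  ultimately have "f \<in> weak_space M a0"
    unfolding gh(1) by (intro weak_space_add)
  then obtain B where B: "0 < B" "weak_bound M a0 B f" by (auto simp: weak_space_def)
  have bd: "m n powr (a0 - b) \<le> B * 2 powr a0 * 2 powr b" for n
  proof -
    let ?s = "(2 * m n) powr - b"
    have "ennreal (m n / 2) < ennreal (m n)" using m1[of n] by (simp add: ennreal_less_iff)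
    also have "\<dots> \<le> emeasure M {x \<in> space M. ?s < cmod (f x)}"
      unfolding A(2)[symmetric]
    proof (intro emeasure_mono subsetI)
      fix x assume x: "x \<in> A n"
      have "m (N x) < 2 * m n" using m_mono[OF N_le[OF x]] m1[of n] by simp
      then have "?s < cmod (f x)" using m1[of "N x"] ab by (simp add: cf powr_less_mono2_neg)
      then show "x \<in> {x \<in> space M. ?s < cmod (f x)}"
        using x sets.sets_into_space[OF A(1)] by blast
    qed (use f_meas in measurable)
    finally have "ennreal ?s \<le> rearrangement M f (m n / 2)"
      by (rule rearrangement_ge[OF f_meas])
    also have "\<dots> \<le> ennreal (B * (m n / 2) powr - a0)"
      using B m1[of n] by (simp add: weak_bound_def)
    finally have "?s \<le> B * (m n / 2) powr - a0" using B by (simp add: ennreal_le_iff)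
    then show ?thesis
      using m1[of n] by (simp add: powr_minus powr_diff powr_mult powr_divide field_simps)
  qed
  obtain n where "(B * 2 powr a0 * 2 powr b) powr (1 / (a0 - b)) < m n" using m_unb by blast
  then have "((B * 2 powr a0 * 2 powr b) powr (1 / (a0 - b))) powr (a0 - b) < m n powr (a0 - b)"
    using ab by (intro powr_less_mono2) auto
  then have "B * 2 powr a0 * 2 powr b < m n powr (a0 - b)"
    using ab B by (simp add: powr_powr)
  with bd[of n] show False by simp
qed

lemma weak_bound_decomposition:
  fixes p0 p p1 s1 r :: ennreal
  assumes "sigma_finite_measure M" "0 < p0" "p0 < p" "p < p1" "0 < r" "endpoint_index p1 s1"
    and fin: "p1 = \<infinity> \<Longrightarrow> s1 = 1 \<Longrightarrow>
      lorentz_space M p r \<subseteq> space_sum (lorentz_space M p0 1) (lorentz_space M p1 s1)"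
  obtains C where "0 < C"
    "\<And>d f. 0 < d \<Longrightarrow> f \<in> borel_measurable M \<Longrightarrow> weak_bound M (enn2real (1 / p)) d f \<Longrightarrow>
      \<exists>g\<in>lorentz_space M p0 1. \<exists>h\<in>lorentz_space M p1 s1. f = (\<lambda>x. g x + h x) \<and>
        lorentz_norm M p0 1 g \<le> ennreal (C * d) \<and> lorentz_norm M p1 s1 h \<le> ennreal (C * d)"
proof -
  define a where "a = enn2real (1 / p)"
  define a0 where "a0 = enn2real (1 / p0)"
  define a1 where "a1 = enn2real (1 / p1)"
  have a: "0 \<le> a1" "a1 < a" "a < a0"
    using enn2real_recip_strict_antimono[of p0 p] enn2real_recip_strict_antimono[of p p1] assms
    by (auto simp: a_def a0_def a1_def)
  consider "p1 = \<infinity>" "s1 = 1" | "s1 = 1 \<and> 0 < a1 \<or> p1 = \<infinity> \<and> s1 = \<infinity>"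
  proof (cases "p1 = \<infinity>")
    case False
    then have "0 < a1" using enn2real_recip[of p1] assms by (auto simp: a1_def less_top)
    then show ?thesis using that assms False by (auto simp: endpoint_index_def)
  qed (use assms that in \<open>auto simp: endpoint_index_def\<close>)
  then show ?thesis
  proof cases
    case 1
    define c where "c = measure M (space M)"
    have "emeasure M (space M) < \<infinity>"
    proof (rule finite_measure_of_lorentz_subset)
      show "lorentz_space M p r \<subseteq> space_sum (lorentz_space M p0 1) (lorentz_space M \<infinity> 1)"
        using fin[OF 1] 1 by simp
    qed (use assms a in \<open>auto simp flip: a_def a0_def\<close>)
    then have c: "emeasure M (space M) = ennreal c"
      unfolding c_def by (intro emeasure_eq_ennreal_measure) auto
    let ?C = "c powr (a0 - a) / (a0 - a) + 1"
    show ?thesis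
    proof (rule that)
      show "0 < ?C" using a by (simp add: add_nonneg_pos)
      fix d f assume f: "0 < d" "f \<in> borel_measurable M" "weak_bound M (enn2real (1 / p)) d f"
      have "lorentz_norm M p0 1 f \<le> ennreal (d * (c powr (a0 - a) / (a0 - a)))"
        unfolding a0_def
      proof (rule lorentz_norm_1_le)
        fix t :: real assume t: "c < t"
        show "rearrangement M f t = 0"
        proof (rule rearrangement_eq_0)
          fix s
          have "emeasure M {x \<in> space M. s < cmod (f x)} \<le> emeasure M (space M)"
            by (intro emeasure_mono) auto
          also have "\<dots> \<le> ennreal t" unfolding c using t by (intro ennreal_leI) simp
          finally show "emeasure M {x \<in> space M. s < cmod (f x)} \<le> ennreal t" .
        qed
      qed (use f a in \<open>auto simp: weak_bound_def c_def a_def a0_def\<close>)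
      also have "\<dots> \<le> ennreal (?C * d)"
        using f by (intro ennreal_leI) (simp add: algebra_simps)
      finally have g: "lorentz_norm M p0 1 f \<le> ennreal (?C * d)" .
      then have "f \<in> lorentz_space M p0 1"
        using f by (auto simp: lorentz_space_def intro: le_less_trans)
      then show "\<exists>g\<in>lorentz_space M p0 1. \<exists>h\<in>lorentz_space M p1 s1. f = (\<lambda>x. g x + h x) \<and>
          lorentz_norm M p0 1 g \<le> ennreal (?C * d) \<and> lorentz_norm M p1 s1 h \<le> ennreal (?C * d)"
        using g 1 by (intro bexI[of _ f] bexI[of _ "\<lambda>x. 0"]) (auto simp: zero_in_lorentz_space lorentz_norm_zero)
    qed
  next
    case 2
    let ?C = "1 / (a0 - a) + 2 + 2 * (1 / a1 + 1 / (a - a1))"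
    show ?thesis
    proof (rule that)
      show "0 < ?C" using a by (intro add_pos_nonneg add_nonneg_pos) auto
      fix d f assume f: "0 < d" "f \<in> borel_measurable M" "weak_bound M (enn2real (1 / p)) d f"
      then obtain g h where "f = (\<lambda>x. g x + h x)" "g \<in> borel_measurable M" "h \<in> borel_measurable M"
          "lorentz_norm M p0 1 g \<le> ennreal (?C * d)" "lorentz_norm M p1 s1 h \<le> ennreal (?C * d)"
        using a 2 weak_bound_split[of f M a d p1 p0 s1] by (auto simp: a_def a0_def a1_def)
      then show "\<exists>g\<in>lorentz_space M p0 1. \<exists>h\<in>lorentz_space M p1 s1. f = (\<lambda>x. g x + h x) \<and>
          lorentz_norm M p0 1 g \<le> ennreal (?C * d) \<and> lorentz_norm M p1 s1 h \<le> ennreal (?C * d)"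
        by (intro bexI[of _ g] bexI[of _ h]) (auto simp: lorentz_space_def intro: le_less_trans)
    qed
  qed
qed

section \<open>Finite quasi-additivity\<close>

lemma dyadic_merge:
  fixes m :: "'i set \<Rightarrow> real" and e :: "'i set \<Rightarrow> nat"
  assumes sub: "\<And>A B. A \<subseteq> I \<Longrightarrow> B \<subseteq> I \<Longrightarrow> A \<noteq> {} \<Longrightarrow> B \<noteq> {} \<Longrightarrow> A \<inter> B = {}
        \<Longrightarrow> m (A \<union> B) \<le> 2 * max (m A) (m B)"
    and "0 \<le> d" "finite P" "P \<noteq> {}" "disjoint P" "{} \<notin> P" "\<Union>P \<subseteq> I"
    and "\<And>X. X \<in> P \<Longrightarrow> m X \<le> d * 2 ^ e X" "(\<Sum>X\<in>P. 2 ^ e X) \<le> (2::nat) ^ k"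
  shows "m (\<Union>P) \<le> d * 2 ^ k"
  using assms(3-)
proof (induction "card P" arbitrary: P e k rule: less_induct)
  case less
  show ?case
  proof (cases "inj_on e P")
    case True
    have "Max (e ` P) \<in> e ` P" using less.prems by (intro Max_in) auto
    then obtain X where X: "X \<in> P" "e X = Max (e ` P)" by auto
    have eX: "2 ^ e X \<le> (2::nat) ^ k"
      using member_le_sum[of X P "\<lambda>X. 2 ^ e X :: nat"] X(1) less.prems(1,7)
      by (meson le_trans zero_le)
    define Q where "Q = P - {X}"
    show ?thesis
    proof (cases "Q = {}")
      case True
      then have "P = {X}" using X by (auto simp: Q_def)
      moreover have "d * 2 ^ e X \<le> d * 2 ^ k"
        using eX assms(2) by (intro mult_left_mono power_increasing) auto
      ultimately show ?thesis using less.prems(6)[OF X(1)] by simp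
    next
      case False
      have "e Z < e X" if "Z \<in> Q" for Z
      proof -
        have "e Z \<le> e X" using that X less.prems by (auto simp: Q_def)
        moreover have "e Z \<noteq> e X" using that X True by (auto simp: Q_def inj_on_def)
        ultimately show ?thesis by simp
      qed
      then have "(\<Sum>Z\<in>Q. 2 ^ e Z) \<le> (\<Sum>i<e X. (2::nat) ^ i)"
        using True less.prems
        by (subst sum.reindex[of e Q "\<lambda>i. 2 ^ i", unfolded o_def, symmetric])
           (auto simp: Q_def intro: inj_on_subset intro!: sum_mono2)
      also have "\<dots> < 2 ^ e X" by (simp add: lessThan_atLeast0 sum_power2)
      finally have sQ: "(\<Sum>Z\<in>Q. 2 ^ e Z) < (2::nat) ^ e X" .
      have "m (\<Union>Q) \<le> d * 2 ^ e X"
      proof (rule less.hyps)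
        show "card Q < card P" unfolding Q_def using X less.prems by (intro psubset_card_mono) auto
        show "disjoint Q" using less.prems by (auto simp: Q_def disjoint_def)
      qed (use less.prems sQ False in \<open>auto simp: Q_def\<close>)
      moreover have "m X \<le> d * 2 ^ e X" using less.prems X by blast
      moreover have "m (X \<union> \<Union>Q) \<le> 2 * max (m X) (m (\<Union>Q))"
      proof (rule sub)
        show "X \<inter> \<Union>Q = {}" using less.prems X by (auto simp: Q_def disjoint_def)
        obtain Z where "Z \<in> Q" using False by blast
        moreover from this have "Z \<noteq> {}" using less.prems(4) by (auto simp: Q_def)
        ultimately show "\<Union>Q \<noteq> {}" by blast
      qed (use less.prems X in \<open>auto simp: Q_def\<close>)
      moreover have "X \<union> \<Union>Q = \<Union>P" using X by (auto simp: Q_def)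
      ultimately have "m (\<Union>P) \<le> d * 2 ^ Suc (e X)" by auto
      also have "\<dots> \<le> d * 2 ^ k"
      proof -
        obtain Z where "Z \<in> Q" using False by blast
        then have "0 < (\<Sum>Z\<in>Q. (2::nat) ^ e Z)"
          using less.prems by (intro sum_pos) (auto simp: Q_def)
        then have "2 ^ e X < (\<Sum>Z\<in>P. (2::nat) ^ e Z)"
          using X less.prems by (simp add: Q_def sum.remove[of P X])
        also have "\<dots> \<le> 2 ^ k" by (rule less.prems)
        finally have "e X < k" by simp
        then show ?thesis using assms(2) by (intro mult_left_mono power_increasing) auto
      qed
      finally show ?thesis .
    qed
  next
    case False
    then obtain X Y where XY: "X \<in> P" "Y \<in> P" "X \<noteq> Y" "e X = e Y" by (auto simp: inj_on_def)
    define R where "R = P - {X, Y}"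
    have P: "P = insert X (insert Y R)" "X \<notin> R" "Y \<notin> R" using XY by (auto simp: R_def)
    have "X \<inter> Y = {}" "X \<noteq> {}" "Y \<noteq> {}" "\<And>Z. Z \<in> R \<Longrightarrow> Z \<inter> (X \<union> Y) = {}"
      using XY less.prems by (auto simp: R_def disjoint_def)
    note dis = this
    have nR: "X \<union> Y \<notin> R" using dis by blast
    have fR: "finite R" using less.prems by (simp add: R_def)
    define e' where "e' = e(X \<union> Y := Suc (e X))"
    have e'R: "e' Z = e Z" if "Z \<in> R" for Z using that nR by (auto simp: e'_def)
    have "m (\<Union>(insert (X \<union> Y) R)) \<le> d * 2 ^ k"
    proof (rule less.hyps[of _ e'])
      show "card (insert (X \<union> Y) R) < card P"
        using P fR XY nR by simp
      show "disjoint (insert (X \<union> Y) R)"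
        using less.prems dis by (auto simp: P disjoint_def)
      have "(\<Sum>Z\<in>insert (X \<union> Y) R. (2::nat) ^ e' Z) = (\<Sum>Z\<in>P. 2 ^ e Z)"
        using P fR XY nR e'R by (simp add: e'_def)
      then show "(\<Sum>Z\<in>insert (X \<union> Y) R. (2::nat) ^ e' Z) \<le> 2 ^ k"
        using less.prems by simp
      have "m (X \<union> Y) \<le> 2 * max (m X) (m Y)"
        using XY less.prems dis by (intro sub) auto
      also have "\<dots> \<le> 2 * (d * 2 ^ e X)"
        using less.prems(6)[OF XY(1)] less.prems(6)[OF XY(2)] XY(4) by simp
      finally have "m (X \<union> Y) \<le> d * 2 ^ e' (X \<union> Y)" by (simp add: e'_def)
      then show "m Z \<le> d * 2 ^ e' Z" if "Z \<in> insert (X \<union> Y) R" for Z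
        using that e'R less.prems(6) P by auto
    qed (use P fR dis less.prems in auto)
    then show ?thesis by (simp add: P Un_assoc)
  qed
qed

text \<open>The Aoki--Rolewicz argument: round the values \<open>m {i}\<close> up to dyadic multiples of a small
  number; equal values can then be merged without loss.\<close>

lemma aoki_rolewicz:
  fixes m :: "'i set \<Rightarrow> real"
  assumes sub: "\<And>A B. A \<subseteq> I \<Longrightarrow> B \<subseteq> I \<Longrightarrow> A \<noteq> {} \<Longrightarrow> B \<noteq> {} \<Longrightarrow> A \<inter> B = {}
        \<Longrightarrow> m (A \<union> B) \<le> 2 * max (m A) (m B)"
    and I: "finite I" "I \<noteq> {}" and nonneg: "\<And>i. i \<in> I \<Longrightarrow> 0 \<le> m {i}"
  shows "m I \<le> 4 * (\<Sum>i\<in>I. m {i})"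
proof -
  have bound: "m I \<le> 4 * (\<Sum>i\<in>I. m {i}) + 2 * card I * d" if d: "0 < d" for d :: real
  proof -
    define E where "E x = (LEAST n. x \<le> d * 2 ^ n)" for x :: real
    have E: "x \<le> d * 2 ^ E x" for x
      unfolding E_def
    proof (rule LeastI_ex)
      obtain n where "x / d < 2 ^ n" using real_arch_pow[of 2 "x / d"] by auto
      then show "\<exists>n. x \<le> d * 2 ^ n" using d by (auto simp: field_simps intro!: exI[of _ n])
    qed
    have E_le: "d * 2 ^ E x \<le> d + 2 * x" if "0 \<le> x" for x
    proof (cases "E x")
      case (Suc n)
      then have "\<not> x \<le> d * 2 ^ n" using not_less_Least[of n "\<lambda>n. x \<le> d * 2 ^ n"] by (simp add: E_def)
      then show ?thesis using Suc d by simp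
    qed (use that in simp)
    define e where "e X = E (m X)" for X
    let ?S = "\<Sum>i\<in>I. (2::nat) ^ e {i}"
    define k where "k = (LEAST k. ?S \<le> 2 ^ k)"
    have k: "?S \<le> 2 ^ k"
      unfolding k_def by (rule LeastI_ex) (meson less_exp less_imp_le)
    have S1: "1 \<le> ?S"
      using I by (metis One_nat_def Suc_leI sum_pos zero_less_numeral zero_less_power)
    have k_le: "2 ^ k \<le> 2 * ?S"
    proof (cases k)
      case (Suc j)
      then have "\<not> ?S \<le> 2 ^ j" using not_less_Least[of j "\<lambda>k. ?S \<le> 2 ^ k"] by (simp add: k_def)
      then show ?thesis using Suc by simp
    qed (use S1 in simp)
    have "m (\<Union>((\<lambda>i. {i}) ` I)) \<le> d * 2 ^ k"
    proof (rule dyadic_merge[where I = I and e = e])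
      show "disjoint ((\<lambda>i. {i}) ` I)" by (auto simp: disjoint_def)
      show "(\<Sum>X\<in>(\<lambda>i. {i}) ` I. 2 ^ e X) \<le> (2::nat) ^ k"
        using k by (subst sum.reindex) (auto simp: o_def)
    qed (use sub I d E in \<open>auto simp: e_def\<close>)
    also have "d * 2 ^ k \<le> d * (2 * real ?S)"
    proof (intro mult_left_mono)
      have "real (2 ^ k) \<le> real (2 * ?S)" using k_le by (rule of_nat_mono)
      then show "2 ^ k \<le> 2 * real ?S" by (simp only: of_nat_power of_nat_mult of_nat_numeral)
    qed (use d in simp)
    also have "\<dots> = 2 * (\<Sum>i\<in>I. d * 2 ^ e {i})"
      by (simp flip: sum_distrib_left)
    also have "\<dots> \<le> 2 * (\<Sum>i\<in>I. d + 2 * m {i})"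
      using nonneg E_le by (intro mult_left_mono sum_mono) (auto simp: e_def)
    also have "\<dots> = 4 * (\<Sum>i\<in>I. m {i}) + 2 * card I * d"
      by (simp add: sum.distrib distrib_left flip: sum_distrib_left)
    finally show ?thesis by simp
  qed
  have "m I \<le> 4 * (\<Sum>i\<in>I. m {i}) + e" if e: "0 < e" for e
  proof -
    have c: "0 < real (card I)" using I by (simp add: card_gt_0_iff)
    then show ?thesis using bound[of "e / (2 * card I)"] e by simp
  qed
  then show ?thesis by (rule field_le_epsilon)
qed

lemma sum_le_of_subadditive:
  fixes m :: "'i set \<Rightarrow> real"
  assumes "\<And>A B. A \<subseteq> I \<Longrightarrow> B \<subseteq> I \<Longrightarrow> A \<noteq> {} \<Longrightarrow> B \<noteq> {} \<Longrightarrow> A \<inter> B = {}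
        \<Longrightarrow> m (A \<union> B) \<le> m A + m B"
    and "finite I" "I \<noteq> {}"
  shows "m I \<le> (\<Sum>i\<in>I. m {i})"
proof -
  have "J \<subseteq> I \<longrightarrow> m J \<le> (\<Sum>i\<in>J. m {i})" if "finite J" "J \<noteq> {}" for J
    using that
  proof (induction rule: finite_ne_induct)
    case (insert x J)
    show ?case
    proof
      assume "insert x J \<subseteq> I"
      then have "m ({x} \<union> J) \<le> m {x} + m J" "m J \<le> (\<Sum>i\<in>J. m {i})"
        using insert assms(1)[of "{x}" J] by auto
      then show "m (insert x J) \<le> (\<Sum>i\<in>insert x J. m {i})" using insert by simp
    qed
  qed simp
  then show ?thesis using assms by blast
qed

lemma infsum_bound_of_partial_sums:
  fixes v :: "int \<Rightarrow> real" and \<rho> :: "nat \<Rightarrow> real"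
  assumes "0 < \<alpha>" "0 < c" "\<And>n. 0 \<le> \<rho> n" "\<And>s. 0 < s \<Longrightarrow> \<exists>n. \<rho> n \<le> s"
    and le: "\<And>n. x powr \<alpha> \<le> c * ((\<Sum>j\<in>{- int n..int n}. v j powr \<alpha>) + \<rho> n powr \<alpha>)"
  shows "ennreal (x powr \<alpha>) \<le> ennreal c * (\<Sum>\<^sub>\<infinity>j. ennreal (v j powr \<alpha>))"
proof (rule ennreal_le_epsilon)
  fix e :: real assume e: "0 < e"
  have "0 < (e / c) powr (1 / \<alpha>)" using assms(2) e by simp
  then obtain n where n: "\<rho> n \<le> (e / c) powr (1 / \<alpha>)"
    using assms(4) by blast
  then have "\<rho> n powr \<alpha> \<le> ((e / c) powr (1 / \<alpha>)) powr \<alpha>"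
    using assms by (intro powr_mono2) auto
  then have "\<rho> n powr \<alpha> \<le> e / c" using assms e by (simp add: powr_powr)
  then have "c * \<rho> n powr \<alpha> \<le> e" using assms(2) by (simp add: field_simps)
  with le[of n] have "x powr \<alpha> \<le> c * (\<Sum>j\<in>{- int n..int n}. v j powr \<alpha>) + e"
    by (simp add: distrib_left)
  then have "ennreal (x powr \<alpha>) \<le> ennreal (c * (\<Sum>j\<in>{- int n..int n}. v j powr \<alpha>) + e)"
    by (rule ennreal_leI)
  also have "\<dots> = ennreal c * (\<Sum>j\<in>{- int n..int n}. ennreal (v j powr \<alpha>)) + ennreal e"
    using assms e by (simp add: ennreal_plus ennreal_mult sum_nonneg sum_ennreal)
  also have "(\<Sum>j\<in>{- int n..int n}. ennreal (v j powr \<alpha>)) \<le> (\<Sum>\<^sub>\<infinity>j. ennreal (v j powr \<alpha>))"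
    by (subst nonneg_infsum_complete) (auto intro!: SUP_upper)
  finally show "ennreal (x powr \<alpha>) \<le> ennreal c * (\<Sum>\<^sub>\<infinity>j. ennreal (v j powr \<alpha>)) + ennreal e"
    by (simp add: add_right_mono mult_left_mono)
qed

section \<open>Countable quasi-additivity\<close>

lemma emeasure_superlevel_of_lorentz_norm:
  assumes u: "u \<in> borel_measurable N" and "0 < t" "0 < s"
    and norm: "lorentz_norm N q \<infinity> u \<le> ennreal e"
    and "e < t powr enn2real (1 / q) * s"
  shows "emeasure N {y \<in> space N. s < cmod (u y)} \<le> ennreal t"
proof (rule emeasure_superlevel_le[OF u])
  let ?w = "t powr enn2real (1 / q)"
  have "ennreal ?w * rearrangement N u t \<le> lorentz_norm N q \<infinity> u"
    using assms(2) by (auto simp: lorentz_norm_def intro!: SUP_upper)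
  also note norm
  also have "ennreal e < ennreal (?w * s)"
    using assms by (intro ennreal_lessI mult_pos_pos) auto
  also have "\<dots> = ennreal ?w * ennreal s"
    using assms by (simp add: ennreal_mult)
  finally have "ennreal ?w * rearrangement N u t < ennreal ?w * ennreal s" .
  then show "rearrangement N u t < ennreal s"
    by (meson mult_left_mono not_less zero_le)
qed

lemma AE_arbitrarily_small:
  fixes R :: "nat \<Rightarrow> 'b \<Rightarrow> complex"
  assumes meas: "\<And>n. R n \<in> borel_measurable N"
    and small: "\<And>s t. 0 < s \<Longrightarrow> 0 < t \<Longrightarrow> \<exists>n. emeasure N {y \<in> space N. s < cmod (R n y)} \<le> ennreal t"
  shows "AE y in N. \<forall>s>0. \<exists>n. cmod (R n y) \<le> s"
proof -
  note [measurable] = meas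
  have "AE y in N. \<exists>n. cmod (R n y) \<le> s" if s: "0 < s" for s
  proof (rule AE_I)
    have "emeasure N {y \<in> space N. \<forall>n. s < cmod (R n y)} \<le> 0 + ennreal t" if t: "0 < t" for t
    proof -
      obtain n where "emeasure N {y \<in> space N. s < cmod (R n y)} \<le> ennreal t"
        using small[OF s t] by blast
      moreover have "emeasure N {y \<in> space N. \<forall>n. s < cmod (R n y)}
          \<le> emeasure N {y \<in> space N. s < cmod (R n y)}"
        by (intro emeasure_mono) auto
      ultimately show ?thesis by simp
    qed
    then have "emeasure N {y \<in> space N. \<forall>n. s < cmod (R n y)} \<le> 0"
      by (rule ennreal_le_epsilon)
    then show "emeasure N {y \<in> space N. \<forall>n. s < cmod (R n y)} = 0" by simp
  qed (auto simp: not_le)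
  then have "AE y in N. \<forall>k. \<exists>n. cmod (R n y) \<le> 1 / real (Suc k)"
    by (subst AE_all_countable) simp
  then show ?thesis
  proof (rule AE_mp, intro AE_I2 impI allI)
    fix y s assume y: "\<forall>k. \<exists>n. cmod (R n y) \<le> 1 / real (Suc k)" and "(0::real) < s"
    then obtain k where "1 / real (Suc k) < s" using nat_approx_posE by metis
    with y show "\<exists>n. cmod (R n y) \<le> s" by (meson less_imp_le order_trans)
  qed
qed

theorem proposition2p7:
  fixes M :: "'a measure" and N :: "'b measure"
    and p0 p p1 s1 q0 q1 r :: ennreal and C0 C1 :: real
    and T :: "('a \<Rightarrow> complex) \<Rightarrow> 'b \<Rightarrow> complex"
    and W :: "('a \<Rightarrow> complex) set"
  assumes "sigma_finite_measure M" and "sigma_finite_measure N"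
    and "0 < p0" and "p0 < p" and "p < p1" and "p1 \<le> \<infinity>"
    and "0 < q0" and "q0 \<le> \<infinity>" and "0 < q1" and "q1 \<le> \<infinity>"
    and "endpoint_index p1 s1"
    and W_def: "W = space_sum (lorentz_space M p0 1) (lorentz_space M p1 s1)"
    and "\<And>f. f \<in> W \<Longrightarrow> T f \<in> borel_measurable N"
    and "0 < C0" and "0 < C1"
    and "\<And>f. f \<in> lorentz_space M p0 1 \<Longrightarrow>
           lorentz_norm N q0 \<infinity> (T f) \<le> ennreal C0 * lorentz_norm M p0 1 f"
    and "\<And>f. f \<in> lorentz_space M p1 s1 \<Longrightarrow>
           lorentz_norm N q1 \<infinity> (T f) \<le> ennreal C1 * lorentz_norm M p1 s1 f"
    and "0 < r" and "r \<le> \<infinity>"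
    and "p1 = \<infinity> \<Longrightarrow> s1 = 1 \<Longrightarrow> lorentz_space M p r \<subseteq> W"
  shows "(\<forall>K \<alpha> :: real. quasi_additive_op N W K T \<longrightarrow> (2 * K) powr \<alpha> = 2
            \<longrightarrow> countably_quasi_additive_op M N p r \<alpha> T)
       \<and> (subadditive_op N W T \<longrightarrow> countably_subadditive_op M N p r T)"
proof -
  note T_meas = assms(13) and T0 = assms(16) and T1 = assms(17)
  define a where "a = enn2real (1 / p)"
  have s1: "0 < s1" using assms(11) by (auto simp: endpoint_index_def)
  obtain C where C: "0 < C" and split:
    "\<And>d f. 0 < d \<Longrightarrow> f \<in> borel_measurable M \<Longrightarrow> weak_bound M a d f \<Longrightarrow>
      \<exists>g\<in>lorentz_space M p0 1. \<exists>h\<in>lorentz_space M p1 s1. f = (\<lambda>x. g x + h x) \<and>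
        lorentz_norm M p0 1 g \<le> ennreal (C * d) \<and> lorentz_norm M p1 s1 h \<le> ennreal (C * d)"
    by (rule weak_bound_decomposition[OF assms(1,3,4,5,18,11) assms(20)[unfolded W_def], folded a_def]) (assumption | rule that)+
  have weak_W: "weak_space M a \<subseteq> W"
  proof
    fix f assume "f \<in> weak_space M a"
    then obtain d where "0 < d" "f \<in> borel_measurable M" "weak_bound M a d f"
      by (auto simp: weak_space_def)
    from split[OF this] show "f \<in> W" by (auto simp: W_def space_sum_def)
  qed
  have L0_W: "lorentz_space M p0 1 \<subseteq> W"
    using zero_in_lorentz_space[OF s1, of M p1] by (force simp: W_def space_sum_def)
  have L1_W: "lorentz_space M p1 s1 \<subseteq> W"
    using zero_in_lorentz_space[of 1 M p0] by (force simp: W_def space_sum_def)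
  have L_weak: "lorentz_space M p r \<subseteq> weak_space M a"
    unfolding a_def using assms(18) by (rule lorentz_space_subset_weak_space)

  define R where "R F f n = (\<lambda>x. f x - (\<Sum>j\<in>{- int n..int n}. F j x))"
    for F :: "int \<Rightarrow> 'a \<Rightarrow> complex" and f n
  have F_weak: "F j \<in> weak_space M a" and f_weak: "f \<in> weak_space M a"
    if "lorentz_series M p r F f" for F f j
    using that L_weak by (auto simp: lorentz_series_def)
  have R_weak: "R F f n \<in> weak_space M a" if "lorentz_series M p r F f" for F f n
  proof -
    have "(\<lambda>x. f x + - (\<Sum>j\<in>{- int n..int n}. F j x)) \<in> weak_space M a"
      by (intro weak_space_add weak_space_uminus weak_space_sum F_weak[OF that] f_weak[OF that])
    then show ?thesis by (simp add: R_def)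
  qed

  have tail: "AE y in N. \<forall>s>0. \<exists>n. cmod (T (R F f n) y) \<le> s"
    if ser: "lorentz_series M p r F f" and K: "0 < K"
      and qa: "\<forall>f\<in>W. \<forall>g\<in>W. AE y in N. cmod (T (\<lambda>x. f x + g x) y) \<le> K * (cmod (T f y) + cmod (T g y))"
    for F f and K :: real
  proof (rule AE_arbitrarily_small)
    show T_R: "T (R F f n) \<in> borel_measurable N" for n
      using R_weak[OF ser] weak_W by (intro T_meas) auto
    fix s t :: real assume s: "0 < s" and t: "0 < t"
    define c where "c = 2 powr (1 / enn2real r + enn2real (1 / p))"
    have c: "0 < c" by (simp add: c_def)
    define s' where "s' = s / (2 * K)"
    have s': "0 < s'" using s K by (simp add: s'_def)
    define z0 where "z0 = (t / 2) powr enn2real (1 / q0) * s'"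
    define z1 where "z1 = (t / 2) powr enn2real (1 / q1) * s'"
    have z: "0 < z0" "0 < z1" using s' t by (simp_all add: z0_def z1_def)
    define d where "d = min (z0 / C0) (z1 / C1) / (2 * C * c)"
    have d: "0 < d" using z C c assms(14,15) by (simp add: d_def)
    have Cd: "C * (c * d) = min (z0 / C0) (z1 / C1) / 2" using C c by (simp add: d_def)
    have m_pos: "0 < min (z0 / C0) (z1 / C1)" using z assms(14,15) by simp
    have half: "v / 2 < u" if "0 < v" "v \<le> u" for u v :: real using that by simp
    have "C * (c * d) < z0 / C0" "C * (c * d) < z1 / C1"
      unfolding Cd using m_pos by (intro half min.cobounded1 min.cobounded2; assumption)+
    then have dz: "C0 * (C * (c * d)) < z0" "C1 * (C * (c * d)) < z1"
      using assms(14,15) by (simp_all add: field_simps)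
    have "\<forall>\<^sub>F n in sequentially. lorentz_norm M p r (R F f n) < ennreal d"
      using ser d unfolding lorentz_series_def R_def by (intro order_tendstoD(2)[of _ 0]) auto
    then obtain n where n: "lorentz_norm M p r (R F f n) < ennreal d"
      by (auto simp: eventually_sequentially)
    have R_meas: "R F f n \<in> borel_measurable M" using R_weak[OF ser, of n] by (simp add: weak_space_def)
    have "weak_bound M a (c * d) (R F f n)"
      unfolding a_def c_def using assms(18) d n by (intro weak_bound_of_lorentz_norm) auto
    from split[OF _ R_meas this] c d obtain g h where gh: "g \<in> lorentz_space M p0 1" "h \<in> lorentz_space M p1 s1"
        "R F f n = (\<lambda>x. g x + h x)"
        "lorentz_norm M p0 1 g \<le> ennreal (C * (c * d))" "lorentz_norm M p1 s1 h \<le> ennreal (C * (c * d))"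
      by auto
    have ghW: "g \<in> W" "h \<in> W" using gh L0_W L1_W by auto
    note [measurable] = T_meas[OF ghW(1)] T_meas[OF ghW(2)]
    have g: "emeasure N {y \<in> space N. s' < cmod (T g y)} \<le> ennreal (t / 2)"
    proof (rule emeasure_superlevel_of_lorentz_norm)
      have "lorentz_norm N q0 \<infinity> (T g) \<le> ennreal C0 * ennreal (C * (c * d))"
        using T0[OF gh(1)] gh(4) by (meson mult_left_mono order_trans zero_le)
      then show "lorentz_norm N q0 \<infinity> (T g) \<le> ennreal (C0 * (C * (c * d)))"
        using assms(14) C c d by (simp add: ennreal_mult)
    qed (use t s' dz T_meas ghW in \<open>auto simp: z0_def\<close>)
    have h: "emeasure N {y \<in> space N. s' < cmod (T h y)} \<le> ennreal (t / 2)"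
    proof (rule emeasure_superlevel_of_lorentz_norm)
      have "lorentz_norm N q1 \<infinity> (T h) \<le> ennreal C1 * ennreal (C * (c * d))"
        using T1[OF gh(2)] gh(5) by (meson mult_left_mono order_trans zero_le)
      then show "lorentz_norm N q1 \<infinity> (T h) \<le> ennreal (C1 * (C * (c * d)))"
        using assms(15) C c d by (simp add: ennreal_mult)
    qed (use t s' dz T_meas ghW in \<open>auto simp: z1_def\<close>)
    have "AE y in N. cmod (T (R F f n) y) \<le> K * (cmod (T g y) + cmod (T h y))"
      using qa ghW unfolding gh(3) by blast
    then have "AE y in N. y \<in> {y \<in> space N. s < cmod (T (R F f n) y)}
        \<longrightarrow> y \<in> {y \<in> space N. s' < cmod (T g y)} \<union> {y \<in> space N. s' < cmod (T h y)}"
    proof (rule AE_mp, intro AE_I2 impI)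
      fix y assume le: "cmod (T (R F f n) y) \<le> K * (cmod (T g y) + cmod (T h y))"
        and y: "y \<in> {y \<in> space N. s < cmod (T (R F f n) y)}"
      have "\<not> (cmod (T g y) \<le> s' \<and> cmod (T h y) \<le> s')"
      proof
        assume "cmod (T g y) \<le> s' \<and> cmod (T h y) \<le> s'"
        then have "K * (cmod (T g y) + cmod (T h y)) \<le> K * (s' + s')"
          using K by (intro mult_left_mono add_mono) auto
        also have "\<dots> = s" using K by (simp add: s'_def field_simps)
        finally show False using le y by simp
      qed
      then show "y \<in> {y \<in> space N. s' < cmod (T g y)} \<union> {y \<in> space N. s' < cmod (T h y)}"
        using y by auto
    qed
    then have "emeasure N {y \<in> space N. s < cmod (T (R F f n) y)}
        \<le> emeasure N ({y \<in> space N. s' < cmod (T g y)} \<union> {y \<in> space N. s' < cmod (T h y)})"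
      by (intro emeasure_mono_AE) measurable
    also have "\<dots> \<le> emeasure N {y \<in> space N. s' < cmod (T g y)} + emeasure N {y \<in> space N. s' < cmod (T h y)}"
      by (intro emeasure_subadditive) measurable
    also have "\<dots> \<le> ennreal (t / 2) + ennreal (t / 2)" by (intro add_mono g h)
    also have "\<dots> = ennreal t" using t by (simp flip: ennreal_plus)
    finally show "\<exists>n. emeasure N {y \<in> space N. s < cmod (T (R F f n) y)} \<le> ennreal t" by blast
  qed

  define G where "G F f n j = (if j = int n + 1 then R F f n else F j)"
    for F :: "int \<Rightarrow> 'a \<Rightarrow> complex" and f n and j :: int
  define S where "S F f n A = (\<lambda>x. \<Sum>j\<in>A. G F f n j x)" for F f n and A :: "int set"
  have I_eq: "{- int n..int n + 1} = insert (int n + 1) {- int n..int n}" for n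
    by auto
  have S_single: "S F f n {j} = G F f n j" for F f n j
    by (simp add: S_def)
  have G_F: "G F f n j = F j" if "j \<in> {- int n..int n}" for F f n j
    using that by (simp add: G_def)
  have S_all: "S F f n {- int n..int n + 1} = f" for F f n
  proof
    fix x
    have "(\<Sum>j\<in>{- int n..int n}. G F f n j x) = (\<Sum>j\<in>{- int n..int n}. F j x)"
      by (intro sum.cong) (auto simp: G_F)
    then show "S F f n {- int n..int n + 1} x = f x"
      by (simp add: S_def I_eq) (simp add: G_def R_def)
  qed
  have sum_I: "(\<Sum>j\<in>{- int n..int n + 1}. \<phi> (G F f n j))
      = (\<Sum>j\<in>{- int n..int n}. \<phi> (F j)) + \<phi> (R F f n)" for F f n and \<phi> :: "('a \<Rightarrow> complex) \<Rightarrow> real"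
  proof -
    have "(\<Sum>j\<in>{- int n..int n}. \<phi> (G F f n j)) = (\<Sum>j\<in>{- int n..int n}. \<phi> (F j))"
      by (intro sum.cong) (auto simp: G_F)
    then show ?thesis by (simp add: I_eq) (simp add: G_def)
  qed
  have unions: "AE y in N. \<forall>n. \<forall>A\<in>Pow {- int n..int n + 1}. \<forall>B\<in>Pow {- int n..int n + 1}.
      A \<inter> B = {} \<longrightarrow> cmod (T (S F f n (A \<union> B)) y) \<le> K * (cmod (T (S F f n A) y) + cmod (T (S F f n B) y))"
    if ser: "lorentz_series M p r F f"
      and qa: "\<forall>f\<in>W. \<forall>g\<in>W. AE y in N. cmod (T (\<lambda>x. f x + g x) y) \<le> K * (cmod (T f y) + cmod (T g y))"
    for F f and K :: real
  proof -
    have SW: "S F f n A \<in> W" for n A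
      using F_weak[OF ser] R_weak[OF ser] weak_W unfolding S_def
      by (intro subsetD[OF weak_W] weak_space_sum) (auto simp: G_def)
    have pair: "AE y in N. A \<inter> B = {} \<longrightarrow>
        cmod (T (S F f n (A \<union> B)) y) \<le> K * (cmod (T (S F f n A) y) + cmod (T (S F f n B) y))"
      if "finite A" "finite B" for n A B
    proof (cases "A \<inter> B = {}")
      case True
      then have "S F f n (A \<union> B) = (\<lambda>x. S F f n A x + S F f n B x)"
        using that by (auto simp: S_def sum.union_disjoint)
      then show ?thesis using qa SW by simp
    qed simp
    show ?thesis
      by (subst AE_all_countable, intro allI AE_finite_allI pair)
         (auto intro: finite_subset[OF _ finite_atLeastAtMost_int])
  qed

  have quasi: "countably_quasi_additive_op M N p r \<alpha> T"
    if op: "quasi_additive_op N W K T" and \<alpha>: "(2 * K) powr \<alpha> = 2" for K \<alpha>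
  proof -
    from op have K: "1 < K"
      and qa: "\<forall>f\<in>W. \<forall>g\<in>W. AE y in N. cmod (T (\<lambda>x. f x + g x) y) \<le> K * (cmod (T f y) + cmod (T g y))"
      by (auto simp: quasi_additive_op_def)
    have "0 < \<alpha>"
    proof (rule ccontr)
      assume "\<not> 0 < \<alpha>"
      then have "(2 * K) powr \<alpha> \<le> (2 * K) powr 0" using K by (intro powr_mono) auto
      with \<alpha> K show False by simp
    qed
    have "\<alpha> \<le> 1"
    proof (rule ccontr)
      assume "\<not> \<alpha> \<le> 1"
      then have "(2 * K) powr 1 \<le> (2 * K) powr \<alpha>" using K by (intro powr_mono) auto
      with \<alpha> K show False by simp
    qed
    have "AE y in N. ennreal (cmod (T f y) powr \<alpha>) \<le> ennreal 4 * (\<Sum>\<^sub>\<infinity>j. ennreal (cmod (T (F j) y) powr \<alpha>))"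
      if ser: "lorentz_series M p r F f" for F f
      using tail[OF ser less_trans[OF zero_less_one K] qa] unions[OF ser qa]
    proof eventually_elim
      case (elim y)
      show ?case
      proof (rule infsum_bound_of_partial_sums)
        fix n
        let ?m = "\<lambda>A. cmod (T (S F f n A) y) powr \<alpha>"
        have "?m {- int n..int n + 1} \<le> 4 * (\<Sum>j\<in>{- int n..int n + 1}. ?m {j})"
        proof (rule aoki_rolewicz)
          fix A B assume "A \<subseteq> {- int n..int n + 1}" "B \<subseteq> {- int n..int n + 1}" "A \<inter> B = {}"
          then have "cmod (T (S F f n (A \<union> B)) y)
              \<le> K * (cmod (T (S F f n A) y) + cmod (T (S F f n B) y))"
            using elim(2) by blast
          also have "\<dots> \<le> K * (2 * max (cmod (T (S F f n A) y)) (cmod (T (S F f n B) y)))"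
            using K by (intro mult_left_mono) auto
          finally have "?m (A \<union> B)
              \<le> ((2 * K) * max (cmod (T (S F f n A) y)) (cmod (T (S F f n B) y))) powr \<alpha>"
            using \<open>0 < \<alpha>\<close> by (intro powr_mono2) (auto simp: mult_ac)
          also have "\<dots> = 2 * max (cmod (T (S F f n A) y)) (cmod (T (S F f n B) y)) powr \<alpha>"
            using K \<alpha> by (simp add: powr_mult le_max_iff_disj)
          also have "max (cmod (T (S F f n A) y)) (cmod (T (S F f n B) y)) powr \<alpha> \<le> max (?m A) (?m B)"
            by (simp add: max_def)
          finally show "?m (A \<union> B) \<le> 2 * max (?m A) (?m B)" by simp
        qed auto
        then show "cmod (T f y) powr \<alpha> \<le> 4 * ((\<Sum>j\<in>{- int n..int n}. cmod (T (F j) y) powr \<alpha>)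
            + cmod (T (R F f n) y) powr \<alpha>)"
          by (simp only: S_all S_single sum_I[of "\<lambda>u. cmod (T u y) powr \<alpha>"])
      qed (use \<open>0 < \<alpha>\<close> elim(1) in auto)
    qed
    then show ?thesis
      using \<open>0 < \<alpha>\<close> \<open>\<alpha> \<le> 1\<close> unfolding countably_quasi_additive_op_def
      by (intro conjI exI[of _ 4]) auto
  qed

  have sub: "countably_subadditive_op M N p r T" if op: "subadditive_op N W T"
    unfolding countably_subadditive_op_def
  proof (intro allI impI)
    fix F f assume ser: "lorentz_series M p r F f"
    have qa: "\<forall>f\<in>W. \<forall>g\<in>W. AE y in N. cmod (T (\<lambda>x. f x + g x) y) \<le> 1 * (cmod (T f y) + cmod (T g y))"
      using op by (simp add: subadditive_op_def)
    show "AE y in N. ennreal (cmod (T f y)) \<le> (\<Sum>\<^sub>\<infinity>j. ennreal (cmod (T (F j) y)))"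
      using tail[OF ser zero_less_one qa] unions[OF ser qa]
    proof eventually_elim
      case (elim y)
      have "ennreal (cmod (T f y) powr 1) \<le> ennreal 1 * (\<Sum>\<^sub>\<infinity>j. ennreal (cmod (T (F j) y) powr 1))"
      proof (rule infsum_bound_of_partial_sums)
        fix n
        let ?m = "\<lambda>A. cmod (T (S F f n A) y)"
        have "?m {- int n..int n + 1} \<le> (\<Sum>j\<in>{- int n..int n + 1}. ?m {j})"
          using elim(2) by (intro sum_le_of_subadditive) auto
        then have "cmod (T f y) \<le> (\<Sum>j\<in>{- int n..int n}. cmod (T (F j) y)) + cmod (T (R F f n) y)"
          by (simp only: S_all S_single sum_I[of "\<lambda>u. cmod (T u y)"])
        then show "cmod (T f y) powr 1 \<le> 1 * ((\<Sum>j\<in>{- int n..int n}. cmod (T (F j) y) powr 1)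
            + cmod (T (R F f n) y) powr 1)"
          by simp
      qed (use elim(1) in auto)
      then show ?case by simp
    qed
  qed
  show ?thesis using quasi sub by blast
qed

end
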